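(* Let $\phi\in\mathbf{B}$ with triplet $(m,\sigma^2,\Pi)$, and let $\mathbb{G}_\phi$ be the operator defined on $C_c(\mathbb{Z}_+)$ by $$\mathbb{G}_\phi f(n)=\sigma^2 n(\partial_++\partial_-)f(n)+(m+\sigma^2)\partial_+f(n)+\frac{1}{n+1}\int_0^\infty\left[\mathbb{D}_{e^{-y}}f(n+1)-f(n+1)+y(n+1)\partial_+f(n)\right]\Pi(dy).$$ Then $(\mathbb{G}_\phi,C_c(\mathbb{Z}_+))$ generates a Feller Markov chain on $\mathbb{Z}_+$, this chain is discrete self-similar, and $C_c(\mathbb{Z}_+)$ is a core for its generator.
   Context: $\mathbb{Z}_+=\{0,1,2,\dots\}$; $C(\mathbb{Z}_+)$, $C_b(\mathbb{Z}_+)$, $C_0(\mathbb{Z}_+)$, $C_c(\mathbb{Z}_+)$ denote respectively all functions, bounded functions, functions vanishing at infinity, and finitely supported functions on $\mathbb{Z}_+$. $\mathbf{B}$ is the class of functions $\phi(u)=m+\sigma^2u+\int_0^\infty(1-e^{-uy})\overline{\Pi}(y)\,dy$, $u\ge 0$, where $m,\sigma^2\ge 0$ and $\Pi$ is a nonnegative measure on $(0,\infty)$ with $\int_0^\infty (y\wedge y^2)\,\Pi(dy)<\infty$, and $\overline{\Pi}(y)=\Pi((y,\infty))$; $(m,\sigma^2,\Pi)$ is the triplet of $\phi$. $\partial_{\pm}f(n)=f(n\pm1)-f(n)$, with the convention $n\,\partial_-f(n)=0$ at $n=0$. Discrete dilation: for $\alpha\ge 0$ and $f\in C(\mathbb{Z}_+)$,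 $\mathbb{D}_\alpha f(n)=\sum_{r=0}^n\binom{n}{r}\alpha^r(1-\alpha)^{n-r}f(r)$ (with $0^0=1$). It is a Markov kernel for $\alpha\in[0,1]$. A continuous-time Markov chain on $\mathbb{Z}_+$ with semigroup $(\mathbb{Q}_t)_{t\ge0}$ is discrete self-similar if for all $t\ge0$ and $\alpha\in[0,1]$, $\mathbb{Q}_t\mathbb{D}_\alpha=\mathbb{D}_\alpha\mathbb{Q}_{\alpha t}$ on $C_b(\mathbb{Z}_+)$. A Feller Markov chain is one whose semigroup is a strongly continuous, positive, conservative contraction semigroup on $C_0(\mathbb{Z}_+)$. *)

theory Defs
  imports "HOL-Probability.Probability"
begin

section \<open>Function spaces on the nonnegative integers\<close>

definition Cb :: "(nat \<Rightarrow> real) set" where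
  "Cb = {f. bounded (range f)}"

definition C0 :: "(nat \<Rightarrow> real) set" where
  "C0 = {f. f \<longlonglongrightarrow> 0}"

definition Cc :: "(nat \<Rightarrow> real) set" where
  "Cc = {f. finite {n. f n \<noteq> 0}}"

section \<open>The class of functions and its triplets\<close>

text \<open>
  The measure \<open>\<mu>\<close> (usually written \<open>\<Pi>\<close>, which is reserved syntax here) lives
  on the Borel sets of the open half-line and may be infinite near 0; its tail is finite at every \<open>y > 0\<close> by the integrability condition, so the real-valued
  \<open>measure\<close> is the true tail there. Only the values of \<open>\<phi>\<close> on \<open>u \<ge> 0\<close> matter.
\<close>
definition has_triplet :: "(real \<Rightarrow> real) \<Rightarrow> real \<Rightarrow> real \<Rightarrow> real measure \<Rightarrow> bool" where
  "has_triplet \<phi> m \<sigma>2 \<mu> \<longleftrightarrow>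
     m \<ge> 0 \<and> \<sigma>2 \<ge> 0 \<and>
     sets \<mu> = sets (restrict_space borel {0<..}) \<and>
     (\<integral>\<^sup>+ y. ennreal (min y (y\<^sup>2)) \<partial>\<mu>) < \<infinity> \<and>
     (\<forall>u\<ge>0. \<phi> u = m + \<sigma>2 * u +
        (LINT y:{0<..}|lborel. (1 - exp (- u * y)) * measure \<mu> {y<..}))"

definition class_B :: "(real \<Rightarrow> real) set" where
  "class_B = {\<phi>. \<exists>m \<sigma>2 \<mu>. has_triplet \<phi> m \<sigma>2 \<mu>}"

section \<open>The operator\<close>

definition dplus :: "(nat \<Rightarrow> real) \<Rightarrow> nat \<Rightarrow> real" where
  "dplus f n = f (n + 1) - f n"

text \<open>Natural subtraction gives \<open>dminus f 0 = 0\<close>, in accordance with the convention at 0.\<close>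
definition dminus :: "(nat \<Rightarrow> real) \<Rightarrow> nat \<Rightarrow> real" where
  "dminus f n = f (n - 1) - f n"

definition dilation :: "real \<Rightarrow> (nat \<Rightarrow> real) \<Rightarrow> nat \<Rightarrow> real" where
  "dilation \<alpha> f n = (\<Sum>r=0..n. real (n choose r) * \<alpha> ^ r * (1 - \<alpha>) ^ (n - r) * f r)"

definition G_op :: "real \<Rightarrow> real \<Rightarrow> real measure \<Rightarrow> (nat \<Rightarrow> real) \<Rightarrow> nat \<Rightarrow> real" where
  "G_op m \<sigma>2 \<mu> f n =
     \<sigma>2 * real n * (dplus f n + dminus f n) + (m + \<sigma>2) * dplus f n +
     1 / (real n + 1) *
       (LINT y|\<mu>. dilation (exp (- y)) f (n + 1) - f (n + 1) + y * (real n + 1) * dplus f n)"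

section \<open>Markov chains, Feller property, generators\<close>

text \<open>
  A continuous-time Markov chain is given by its transition function: \<open>P t n\<close> is the law at
  time \<open>t\<close> of the chain started at \<open>n\<close>. Only times \<open>t \<ge> 0\<close> are constrained.
\<close>
definition markov_chain :: "(real \<Rightarrow> nat \<Rightarrow> nat pmf) \<Rightarrow> bool" where
  "markov_chain P \<longleftrightarrow>
     (\<forall>n. P 0 n = return_pmf n) \<and>
     (\<forall>s\<ge>0. \<forall>t\<ge>0. \<forall>n. P (s + t) n = bind_pmf (P s n) (P t))"

definition semigroup_of ::
    "(real \<Rightarrow> nat \<Rightarrow> nat pmf) \<Rightarrow> real \<Rightarrow> (nat \<Rightarrow> real) \<Rightarrow> nat \<Rightarrow> real" where
  "semigroup_of P t f n = measure_pmf.expectation (P t n) f"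

text \<open>
  The last three conjuncts (positive, contraction, conservative) are automatic for operators
  given by probability kernels. Uniform limits over \<open>UNIV\<close> are limits in the supremum norm.
\<close>
definition feller_chain :: "(real \<Rightarrow> nat \<Rightarrow> nat pmf) \<Rightarrow> bool" where
  "feller_chain P \<longleftrightarrow>
     markov_chain P \<and>
     (\<forall>t\<ge>0. \<forall>f\<in>C0. semigroup_of P t f \<in> C0) \<and>
     (\<forall>f\<in>C0. uniform_limit UNIV (\<lambda>t. semigroup_of P t f) f (at_right 0)) \<and>
     (\<forall>t\<ge>0. \<forall>f\<in>C0. (\<forall>n. 0 \<le> f n) \<longrightarrow> (\<forall>n. 0 \<le> semigroup_of P t f n)) \<and>
     (\<forall>t\<ge>0. \<forall>f\<in>C0. (SUP n. \<bar>semigroup_of P t f n\<bar>) \<le> (SUP n. \<bar>f n\<bar>)) \<and>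
     (\<forall>t\<ge>0. \<forall>n. semigroup_of P t (\<lambda>_. 1) n = 1)"

definition discrete_self_similar :: "(real \<Rightarrow> nat \<Rightarrow> nat pmf) \<Rightarrow> bool" where
  "discrete_self_similar P \<longleftrightarrow>
     (\<forall>t\<ge>0. \<forall>\<alpha>\<in>{0..1}. \<forall>f\<in>Cb.
        semigroup_of P t (dilation \<alpha> f) = dilation \<alpha> (semigroup_of P (\<alpha> * t) f))"

text \<open>Unbounded operators on \<open>C0\<close> are represented by their graphs.\<close>
definition generator :: "(real \<Rightarrow> nat \<Rightarrow> nat pmf) \<Rightarrow> ((nat \<Rightarrow> real) \<times> (nat \<Rightarrow> real)) set" where
  "generator P =
     {(f, g). f \<in> C0 \<and> g \<in> C0 \<and>
        uniform_limit UNIV (\<lambda>t n. (semigroup_of P t f n - f n) / t) g (at_right 0)}"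

definition graph_on ::
    "(nat \<Rightarrow> real) set \<Rightarrow> ((nat \<Rightarrow> real) \<Rightarrow> nat \<Rightarrow> real) \<Rightarrow> ((nat \<Rightarrow> real) \<times> (nat \<Rightarrow> real)) set" where
  "graph_on D A = {(f, A f) | f. f \<in> D}"

text \<open>Sequential closure, in the product of the supremum-norm topologies.\<close>
definition graph_closure ::
    "((nat \<Rightarrow> real) \<times> (nat \<Rightarrow> real)) set \<Rightarrow> ((nat \<Rightarrow> real) \<times> (nat \<Rightarrow> real)) set" where
  "graph_closure R =
     {(f, g). \<exists>F H. (\<forall>k::nat. (F k, H k) \<in> R) \<and>
        uniform_limit UNIV F f sequentially \<and> uniform_limit UNIV H g sequentially}"

text \<open>\<open>(A, D)\<close> generates the chain \<open>P\<close> if its closure is the generator of \<open>P\<close>.\<close>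
definition generates ::
    "((nat \<Rightarrow> real) \<Rightarrow> nat \<Rightarrow> real) \<Rightarrow> (nat \<Rightarrow> real) set \<Rightarrow> (real \<Rightarrow> nat \<Rightarrow> nat pmf) \<Rightarrow> bool" where
  "generates A D P \<longleftrightarrow> graph_closure (graph_on D A) = generator P"

definition core :: "(nat \<Rightarrow> real) set \<Rightarrow> ((nat \<Rightarrow> real) \<times> (nat \<Rightarrow> real)) set \<Rightarrow> bool" where
  "core D L \<longleftrightarrow> D \<subseteq> Domain L \<and> graph_closure (L \<inter> D \<times> UNIV) = L"

end

theory Submission
  imports Defs "HOL-Real_Asymp.Real_Asymp"
begin

text \<open>
  On functions of \<open>n\<close> the operator acts as a \<open>Q\<close>-matrix whose only upward jumps have size one, and
  the harmonic numbers \<open>harm n\<close> satisfy \<open>\<Sum>k. q n k * \<bar>harm k - harm n\<bar> \<le> C\<close>: the thinning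
  of \<open>harm\<close> by \<open>exp (- y)\<close> loses at most \<open>y\<close>, as in the series of \<open>- ln (exp (- y))\<close>. This one
  estimate carries the whole argument. It makes \<open>harm n + C * t\<close> a barrier in a comparison
  principle, whence bounded solutions of the backward equation \<open>u' = G u\<close> are unique and are limits
  of truncated systems, which yields the chain and its semigroup; it makes \<open>1 / (1 + harm n)\<close> a
  weight that the semigroup preserves, whence the Feller property; and it makes the commutator of
  \<open>G\<close> with the cutoffs \<open>max 0 (1 - harm n / j)\<close> of size \<open>1 / j\<close>, whence finitely supported
  functions form a core of the maximal operator \<open>{(f, G f). f, G f \<in> C0}\<close>, which is the generator.
  Self-similarity follows from \<open>G \<circ> D\<^sub>\<alpha> = \<alpha> D\<^sub>\<alpha> \<circ> G\<close>, checked on the binomial coefficients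
  \<open>n choose j\<close>, and uniqueness.
\<close>

section \<open>Function spaces and dilations\<close>

lemma CbI: "(\<And>n. \<bar>f n\<bar> \<le> B) \<Longrightarrow> f \<in> Cb"
  by (auto simp: Cb_def bounded_iff)

lemma CbD: "f \<in> Cb \<Longrightarrow> \<exists>B\<ge>0. \<forall>n. \<bar>f n\<bar> \<le> B"
  unfolding Cb_def bounded_iff by (auto intro: order.trans[OF abs_ge_zero])

lemma Cb_cmult: "f \<in> Cb \<Longrightarrow> (\<lambda>n. c * f n) \<in> Cb"
proof -
  assume "f \<in> Cb"
  then obtain B where "\<And>n. \<bar>f n\<bar> \<le> B" using CbD by blast
  then show ?thesis by (intro CbI[of _ "\<bar>c\<bar> * B"]) (simp add: abs_mult mult_left_mono)
qed

lemma C0_subset_Cb: "C0 \<subseteq> Cb"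
  by (auto simp: C0_def Cb_def intro: convergent_imp_bounded)

lemma C0E:
  assumes "f \<in> C0" "0 < e" obtains K where "\<And>n. K \<le> n \<Longrightarrow> \<bar>f n\<bar> < e"
  using LIMSEQ_D[of f 0 e] assms by (auto simp: C0_def)

lemma C0_uniform_limit:
  assumes "\<And>k::nat. F k \<in> C0" and "uniform_limit UNIV F f sequentially"
  shows "f \<in> C0"
  unfolding C0_def mem_Collect_eq
proof (rule LIMSEQ_I)
  fix r :: real assume "0 < r"
  then have "\<forall>\<^sub>F k in sequentially. \<forall>n. dist (F k n) (f n) < r / 2"
    using uniform_limitD[OF assms(2), of "r / 2"] by simp
  then obtain k where k: "\<And>n. dist (F k n) (f n) < r / 2"
    using eventually_happens'[OF sequentially_bot] by blast
  obtain K where K: "\<And>n. K \<le> n \<Longrightarrow> \<bar>F k n\<bar> < r / 2"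
    using C0E[OF assms(1), of "r / 2" k] \<open>0 < r\<close> by auto
  have "norm (f n - 0) < r" if "K \<le> n" for n
    using k[of n] K[OF that] unfolding dist_real_def real_norm_def by linarith
  then show "\<exists>K. \<forall>n\<ge>K. norm (f n - 0) < r" by blast
qed

lemma Cc_subset_C0: "Cc \<subseteq> C0"
proof
  fix f assume "f \<in> Cc"
  then obtain K where "{n. f n \<noteq> 0} \<subseteq> {..<K}" by (auto simp: Cc_def finite_nat_iff_bounded)
  then show "f \<in> C0"
    unfolding C0_def mem_Collect_eq
    by (intro tendsto_eventually eventually_sequentiallyI[of K]) (auto simp: subset_eq leD)
qed

lemma C0_approx_Cc:
  assumes "f \<in> C0" "0 < e" shows "\<exists>g\<in>Cc. \<forall>n. \<bar>f n - g n\<bar> \<le> e"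
proof -
  obtain K where "\<And>n. K \<le> n \<Longrightarrow> \<bar>f n\<bar> < e" using C0E assms by blast
  then show ?thesis using assms(2)
    by (intro bexI[of _ "\<lambda>n. if n < K then f n else 0"])
      (auto simp: Cc_def less_imp_le intro: finite_subset[of _ "{..<K}"])
qed

text \<open>A bounded function is integrable against a probability measure, and rewriting that
  measure as a density over counting measure turns the expectation into a convergent series. This is
  the form in which \<open>flow_sums\<close> can be matched with
  \<open>semigroup_of\<close>.\<close>

lemma expectation_pmf_nat_sums:
  fixes f :: "nat \<Rightarrow> real"
  assumes "f \<in> Cb"
  shows "(\<lambda>k. pmf p k * f k) sums measure_pmf.expectation p f"
proof -
  obtain B where "\<And>n. \<bar>f n\<bar> \<le> B" using CbD[OF assms(1)] by blast
  then have "integrable (measure_pmf p) f"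
    by (intro measure_pmf.integrable_const_bound[of _ B]) auto
  then have "integrable (count_space UNIV) (\<lambda>k. pmf p k * f k)"
    unfolding measure_pmf_eq_density by (subst (asm) integrable_density) auto
  then have "(\<lambda>k. pmf p k * f k) sums (\<integral>k. pmf p k * f k \<partial>count_space UNIV)"
    by (rule sums_integral_count_space_nat)
  also have "(\<integral>k. pmf p k * f k \<partial>count_space UNIV) = measure_pmf.expectation p f"
    unfolding measure_pmf_eq_density by (subst integral_density) auto
  finally show ?thesis .
qed

lemma uniform_limit_sum:
  fixes f :: "'i \<Rightarrow> 'a \<Rightarrow> 'b \<Rightarrow> 'c::real_normed_vector"
  assumes "\<And>i. i \<in> I \<Longrightarrow> uniform_limit S (f i) (l i) F"
  shows "uniform_limit S (\<lambda>n x. \<Sum>i\<in>I. f i n x) (\<lambda>x. \<Sum>i\<in>I. l i x) F"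
  using assms by (induction I rule: infinite_finite_induct) (auto intro!: uniform_limit_intros)

lemma graph_closureI:
  assumes "\<And>k. (F k, H k) \<in> R"
    and "uniform_limit UNIV F f sequentially" "uniform_limit UNIV H g sequentially"
  shows "(f, g) \<in> graph_closure R"
  unfolding graph_closure_def using assms by blast

section \<open>Binomial thinning and its eigenfunctions\<close>

lemma dilation_const: "dilation \<alpha> (\<lambda>_. c) n = c"
proof -
  have "(\<Sum>r\<le>n. real (n choose r) * \<alpha> ^ r * (1 - \<alpha>) ^ (n - r)) = 1"
    using binomial_ring[of \<alpha> "1 - \<alpha>" n] by simp
  then show ?thesis
    by (simp add: dilation_def atMost_atLeast0 flip: sum_distrib_right)
qed

lemma dilation_bound:
  assumes "0 \<le> \<alpha>" "\<alpha> \<le> 1" "\<And>n. \<bar>f n\<bar> \<le> B"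
  shows "\<bar>dilation \<alpha> f n\<bar> \<le> B"
proof -
  have "\<bar>dilation \<alpha> f n\<bar> \<le> dilation \<alpha> (\<lambda>_. B) n"
    unfolding dilation_def using assms
    by (intro order.trans[OF sum_abs] sum_mono) (auto simp: abs_mult power_abs intro!: mult_left_mono)
  then show ?thesis by (simp add: dilation_const)
qed

lemma dilation_in_Cb: "0 \<le> \<alpha> \<Longrightarrow> \<alpha> \<le> 1 \<Longrightarrow> f \<in> Cb \<Longrightarrow> dilation \<alpha> f \<in> Cb"
  using CbD[of f] dilation_bound[of \<alpha> f] by (metis CbI)

lemma dilation_cmult: "dilation \<alpha> (\<lambda>n. c * f n) n = c * dilation \<alpha> f n"
  by (simp add: dilation_def sum_distrib_left mult_ac)

lemma dilation_cong: "(\<And>r. r \<le> n \<Longrightarrow> f r = g r) \<Longrightarrow> dilation \<alpha> f n = dilation \<alpha> g n"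
  by (simp add: dilation_def)

lemma dilation_add: "dilation \<alpha> (\<lambda>n. f n + g n) n = dilation \<alpha> f n + dilation \<alpha> g n"
  by (simp add: dilation_def sum.distrib algebra_simps)

lemma dilation_sum: "dilation \<alpha> (\<lambda>n. \<Sum>i\<in>I. c i * g i n) n = (\<Sum>i\<in>I. c i * dilation \<alpha> (g i) n)"
  by (induction I rule: infinite_finite_induct) (auto simp: dilation_add dilation_cmult dilation_const)

lemma dilation_0: "dilation \<alpha> f 0 = f 0"
  by (simp add: dilation_def)

text \<open>Pascal's rule; probabilistically, conditioning on whether one of the
  \<open>Suc n\<close> points survives the thinning.\<close>

lemma dilation_Suc: "dilation \<alpha> f (Suc n) = (1 - \<alpha>) * dilation \<alpha> f n + \<alpha> * dilation \<alpha> (\<lambda>r. f (Suc r)) n"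
proof -
  let ?b = "\<lambda>n r. real (n choose r) * \<alpha> ^ r * (1 - \<alpha>) ^ (n - r)"
  have "dilation \<alpha> f (Suc n) = ?b (Suc n) 0 * f 0 + (\<Sum>r\<le>n. ?b (Suc n) (Suc r) * f (Suc r))"
    unfolding dilation_def atMost_atLeast0[symmetric] by (rule sum.atMost_Suc_shift)
  also have "(\<Sum>r\<le>n. ?b (Suc n) (Suc r) * f (Suc r))
      = \<alpha> * dilation \<alpha> (\<lambda>r. f (Suc r)) n + (\<Sum>r\<le>n. real (n choose Suc r) * \<alpha> ^ Suc r * (1 - \<alpha>) ^ (n - r) * f (Suc r))"
    unfolding dilation_def atMost_atLeast0[symmetric] sum_distrib_left sum.distrib[symmetric]
    by (intro sum.cong) (simp_all add: algebra_simps)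
  also have "?b (Suc n) 0 * f 0 + (\<alpha> * dilation \<alpha> (\<lambda>r. f (Suc r)) n
       + (\<Sum>r\<le>n. real (n choose Suc r) * \<alpha> ^ Suc r * (1 - \<alpha>) ^ (n - r) * f (Suc r)))
      = \<alpha> * dilation \<alpha> (\<lambda>r. f (Suc r)) n + (\<Sum>r\<le>Suc n. real (n choose r) * \<alpha> ^ r * (1 - \<alpha>) ^ (Suc n - r) * f r)"
    by (subst sum.atMost_Suc_shift) simp
  also have "(\<Sum>r\<le>Suc n. real (n choose r) * \<alpha> ^ r * (1 - \<alpha>) ^ (Suc n - r) * f r) = (1 - \<alpha>) * dilation \<alpha> f n"
    unfolding dilation_def atMost_atLeast0[symmetric] sum_distrib_left
    by (simp add: binomial_eq_0) (intro sum.cong, simp_all add: Suc_diff_le)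
  finally show ?thesis by simp
qed

text \<open>Factorial moments of the binomial law: \<open>n choose j\<close> is an eigenfunction of
  thinning with eigenvalue \<open>\<alpha> ^ j\<close>. Induction through
  \<open>dilation_Suc\<close> works because the shifted function is again a sum of two binomial
  coefficients.\<close>

lemma dilation_binomial: "dilation \<alpha> (\<lambda>i. real (i choose j)) n = \<alpha> ^ j * real (n choose j)"
proof (induction n arbitrary: j)
  case 0 then show ?case by (cases j) (simp_all add: dilation_0)
next
  case (Suc n)
  show ?case
  proof (cases j)
    case 0 then show ?thesis by (simp add: dilation_const)
  next
    case (Suc i)
    then show ?thesis
      using Suc.IH[of i] Suc.IH[of "Suc i"]
      by (simp add: dilation_Suc dilation_add algebra_simps)
  qed
qed

text \<open>Newton interpolation: the matrix \<open>i choose j\<close> is triangular with unit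
  diagonal. Thinning and the operator read only finitely many values of \<open>f\<close>, so
  identities for them need only be checked on binomial coefficients.\<close>

lemma binomial_basis: "\<exists>c. \<forall>i\<le>N. f i = (\<Sum>j\<le>N. c j * real (i choose j))"
proof (induction N)
  case 0 show ?case by (intro exI[of _ f]) simp
next
  case (Suc N)
  then obtain c where c: "\<And>i. i \<le> N \<Longrightarrow> f i = (\<Sum>j\<le>N. c j * real (i choose j))" by blast
  \<comment> \<open>The new coefficient corrects the error at \<open>Suc N\<close>; at smaller
    arguments \<open>i choose Suc N\<close> vanishes, so earlier values are untouched.\<close>
  define c' where "c' = c(Suc N := f (Suc N) - (\<Sum>j\<le>N. c j * real (Suc N choose j)))"
  have "f i = (\<Sum>j\<le>Suc N. c' j * real (i choose j))" if "i \<le> Suc N" for i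
  proof (cases "i = Suc N")
    case True
    have "(\<Sum>j\<le>N. c' j * real (i choose j)) = (\<Sum>j\<le>N. c j * real (i choose j))"
      by (intro sum.cong) (auto simp: c'_def)
    then show ?thesis using True by (simp add: c'_def)
  next
    case False
    have "(\<Sum>j\<le>N. c' j * real (i choose j)) = (\<Sum>j\<le>N. c j * real (i choose j))"
      by (intro sum.cong) (auto simp: c'_def)
    then show ?thesis using c[of i] False that by (simp add: binomial_eq_0)
  qed
  then show ?case by blast
qed

lemma dilation_of_bool:
  "dilation \<alpha> (\<lambda>j. of_bool (j = k)) n = real (n choose k) * \<alpha> ^ k * (1 - \<alpha>) ^ (n - k)"
proof (cases "k \<le> n")
  case True
  have "dilation \<alpha> (\<lambda>j. of_bool (j = k)) n
      = (\<Sum>r=0..n. if r = k then real (n choose k) * \<alpha> ^ k * (1 - \<alpha>) ^ (n - k) else 0)"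
    unfolding dilation_def by (intro sum.cong) auto
  then show ?thesis using True by simp
qed (auto simp: dilation_def binomial_eq_0 intro!: sum.neutral)

text \<open>The right-hand side is a partial sum of the series of \<open>- ln \<alpha>\<close>.\<close>

lemma harm_minus_dilation_harm:
  "harm n - dilation \<alpha> harm n = (\<Sum>j<n. (1 - \<alpha>) ^ Suc j / real (Suc j))"
proof (induction n)
  case 0 then show ?case by (simp add: dilation_0)
next
  case (Suc n)
  \<comment> \<open>Absorption replaces the weight \<open>1 / Suc r\<close> by the constant
    \<open>1 / Suc n\<close> and shifts the binomial index. What remains is the binomial law for
    \<open>Suc n\<close> points without its atom at 0.\<close>
  have "\<alpha> * dilation \<alpha> (\<lambda>r. inverse (real (Suc r))) n
      = (\<Sum>r\<le>n. real (Suc n choose Suc r) * \<alpha> ^ Suc r * (1 - \<alpha>) ^ (n - r)) / real (Suc n)"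
  proof -
    have "\<alpha> * (real (n choose r) * \<alpha> ^ r * (1 - \<alpha>) ^ (n - r) * inverse (real (Suc r)))
        = real (Suc n choose Suc r) * \<alpha> ^ Suc r * (1 - \<alpha>) ^ (n - r) / real (Suc n)" for r
    proof -
      have "real (Suc r) * real (Suc n choose Suc r) = real (Suc n) * real (n choose r)"
        by (metis Suc_times_binomial of_nat_mult)
      then have "real (n choose r) * inverse (real (Suc r)) = real (Suc n choose Suc r) / real (Suc n)"
        by (simp add: divide_simps mult_ac del: of_nat_Suc binomial_Suc_Suc)
      then have "(real (n choose r) * inverse (real (Suc r))) * (\<alpha> ^ Suc r * (1 - \<alpha>) ^ (n - r))
          = (real (Suc n choose Suc r) / real (Suc n)) * (\<alpha> ^ Suc r * (1 - \<alpha>) ^ (n - r))" by simp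
      then show ?thesis by (simp add: mult_ac del: of_nat_Suc binomial_Suc_Suc)
    qed
    then show ?thesis
      unfolding dilation_def atMost_atLeast0[symmetric] sum_distrib_left sum_divide_distrib by simp
  qed
  also have "(\<Sum>r\<le>n. real (Suc n choose Suc r) * \<alpha> ^ Suc r * (1 - \<alpha>) ^ (n - r)) = 1 - (1 - \<alpha>) ^ Suc n"
  proof -
    have "(\<Sum>r\<le>Suc n. real (Suc n choose r) * \<alpha> ^ r * (1 - \<alpha>) ^ (Suc n - r)) = 1"
      using binomial_ring[of \<alpha> "1 - \<alpha>" "Suc n"] by simp
    then show ?thesis
      by (subst (asm) sum.atMost_Suc_shift) (simp add: algebra_simps)
  qed
  finally have "dilation \<alpha> harm (Suc n) = dilation \<alpha> harm n + (1 - (1 - \<alpha>) ^ Suc n) / real (Suc n)"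
    unfolding dilation_Suc harm_Suc dilation_add by (simp add: algebra_simps)
  then show ?case
    using Suc.IH by (simp add: harm_Suc diff_divide_distrib inverse_eq_divide)
qed

text \<open>The terms are nonnegative, so a partial sum is at most the full series, whose value is
  \<open>- ln (exp (- y)) = y\<close>.\<close>

lemma harm_minus_dilation_harm_le:
  assumes "0 \<le> y" shows "harm n - dilation (exp (- y)) harm n \<le> y"
proof -
  let ?f = "\<lambda>j. (1 - exp (- y)) ^ Suc j / real (Suc j)"
  have x: "0 \<le> 1 - exp (- y)" "1 - exp (- y) < 1" using assms by auto
  have sm: "summable ?f"
  proof (rule summable_comparison_test')
    show "summable (\<lambda>j. (1 - exp (- y)) ^ j)" using x by (intro summable_geometric) simp
    show "norm (?f j) \<le> (1 - exp (- y)) ^ j" for j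
    proof -
      have "norm (?f j) = (1 - exp (- y)) ^ Suc j / real (Suc j)" using x by simp
      also have "\<dots> \<le> (1 - exp (- y)) ^ Suc j / 1" using x by (intro divide_left_mono) auto
      also have "\<dots> \<le> (1 - exp (- y)) ^ j" using x by (simp add: mult_left_le_one_le)
      finally show ?thesis .
    qed
  qed
  have "(\<Sum>j<n. ?f j) \<le> suminf ?f"
    using x by (intro sum_le_suminf[OF sm]) auto
  also have "suminf ?f = - ln (exp (- y))"
  proof -
    have "ln (exp (- y)) = (\<Sum>j. (- 1) ^ j * (1 / real (j + 1)) * (exp (- y) - 1) ^ Suc j)"
      using assms by (intro ln_series) (auto intro: order.strict_trans1[of _ 1])
    also have "(\<lambda>j. (- 1) ^ j * (1 / real (j + 1)) * (exp (- y) - 1) ^ Suc j) = (\<lambda>j. - ?f j)"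
    proof
      fix j
      have "(exp (- y) - 1) ^ Suc j = (- 1) ^ Suc j * (1 - exp (- y)) ^ Suc j"
        by (metis minus_diff_eq power_minus)
      then show "(- 1) ^ j * (1 / real (j + 1)) * (exp (- y) - 1) ^ Suc j = - ?f j"
        by (simp add: power_mult_distrib[symmetric] mult.assoc[symmetric] del: of_nat_Suc)
    qed
    finally show ?thesis using suminf_minus[OF sm] by simp
  qed
  finally show ?thesis by (simp add: harm_minus_dilation_harm)
qed

text \<open>The compensated exponential of the Levy-Khintchine formula; it appears as the jump
  integrand evaluated on binomial coefficients.\<close>

definition compensator :: "real \<Rightarrow> real" where
  "compensator x = exp (- x) - 1 + x"

lemma compensator_nonneg: "0 \<le> compensator x"
  using exp_ge_add_one_self[of "- x"] by (simp add: compensator_def)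

text \<open>For \<open>0 \<le> x\<close> the bound lies below both \<open>x\<close> and the square
  of \<open>x\<close>, which is what the integrability condition on the jump measure asks
  for.\<close>

lemma compensator_le:
  assumes "0 \<le> x" shows "compensator x \<le> x\<^sup>2 / (1 + x)"
proof -
  have "exp (- x) \<le> 1 / (1 + x)"
    using exp_ge_add_one_self[of x] assms by (simp add: exp_minus field_simps)
  then have "compensator x \<le> 1 / (1 + x) - 1 + x" by (simp add: compensator_def)
  also have "\<dots> = x\<^sup>2 / (1 + x)" using assms by (simp add: field_simps power2_eq_square)
  finally show ?thesis .
qed

section \<open>Chains with a Lyapunov function\<close>

text \<open>Only the entries \<open>q n k\<close> with \<open>k \<le> n + 1\<close> enter the generator; the others are junk.\<close>

locale lyapunov_generator =
  fixes q :: "nat \<Rightarrow> nat \<Rightarrow> real" and h :: "nat \<Rightarrow> real" and C :: real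
  assumes q_nonneg: "k \<noteq> n \<Longrightarrow> 0 \<le> q n k"
    and row_sum: "(\<Sum>k\<le>Suc n. q n k) = 0"
    and h_nonneg: "0 \<le> h n"
    and h_at_top: "filterlim h at_top sequentially"
    and h_rate: "(\<Sum>k\<le>Suc n. q n k * \<bar>h k - h n\<bar>) \<le> C"
    and column_tendsto_0: "(\<lambda>n. q n k) \<longlonglongrightarrow> 0"
begin

text \<open>A finite sum in every row, so it also applies to unbounded functions such as
  \<open>h\<close>.\<close>

definition gen :: "(nat \<Rightarrow> real) \<Rightarrow> nat \<Rightarrow> real" where
  "gen f n = (\<Sum>k\<le>Suc n. q n k * f k)"

lemma gen_add: "gen (\<lambda>k. f k + g k) n = gen f n + gen g n"
  and gen_diff: "gen (\<lambda>k. f k - g k) n = gen f n - gen g n"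
  and gen_cmult: "gen (\<lambda>k. c * f k) n = c * gen f n"
  and gen_uminus: "gen (\<lambda>k. - f k) n = - gen f n"
  by (simp_all add: gen_def algebra_simps sum.distrib sum_subtractf sum_distrib_left sum_negf)

lemma gen_const: "gen (\<lambda>_. c) n = 0"
  using row_sum[of n] by (simp add: gen_def flip: sum_distrib_right)

lemmas gen_simps = gen_add gen_diff gen_cmult gen_uminus gen_const

lemma gen_shift: "gen f n = (\<Sum>k\<le>Suc n. q n k * (f k - f n))"
  using gen_const[of "f n" n]
  by (simp add: gen_def algebra_simps sum_subtractf sum.distrib)

text \<open>The diagonal rate has no favourable sign, but \<open>gen_shift\<close> makes its term
  vanish; estimates are therefore required off the diagonal only, plus a sign condition on what
  \<open>g\<close> adds there.\<close>

lemma gen_le: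
  assumes "\<And>k. k \<noteq> n \<Longrightarrow> q n k * (f k - f n) \<le> q n k * g k" "0 \<le> q n n * g n"
  shows "gen f n \<le> (\<Sum>k\<le>Suc n. q n k * g k)"
  unfolding gen_shift
proof (rule sum_mono)
  fix k show "q n k * (f k - f n) \<le> q n k * g k"
    using assms by (cases "k = n") auto
qed

lemma gen_nonpos_at_max: "(\<And>k. f k \<le> f n) \<Longrightarrow> gen f n \<le> 0"
  using gen_le[of n f "\<lambda>_. 0"] by (auto simp: q_nonneg mult_nonneg_nonpos)

lemma C_nonneg: "0 \<le> C"
proof -
  have "0 \<le> (\<Sum>k\<le>Suc 0. q 0 k * \<bar>h k - h 0\<bar>)"
    by (rule sum_nonneg) (metis abs_ge_zero abs_zero diff_self mult_nonneg_nonneg mult_zero_right q_nonneg order.refl)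
  then show ?thesis using h_rate[of 0] by linarith
qed

lemma gen_h_le: "gen h n \<le> C"
proof -
  have "gen h n \<le> (\<Sum>k\<le>Suc n. q n k * \<bar>h k - h n\<bar>)"
    by (rule gen_le) (auto intro!: mult_left_mono q_nonneg)
  then show ?thesis using h_rate[of n] by linarith
qed

text \<open>The difference of the two reciprocals is \<open>h n - h k\<close> over
  \<open>(1 + h n) * (1 + h k)\<close>. Bounding \<open>1 / (1 + h k)\<close> by 1 keeps the factor
  \<open>1 / (1 + h n)\<close>, so the weight grows at most at exponential rate
  \<open>C\<close>.\<close>

lemma gen_inverse_h_le: "gen (\<lambda>k. 1 / (1 + h k)) n \<le> C * (1 / (1 + h n))"
proof -
  have "gen (\<lambda>k. 1 / (1 + h k)) n \<le> (\<Sum>k\<le>Suc n. q n k * (1 / (1 + h n) * \<bar>h k - h n\<bar>))"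
  proof (rule gen_le)
    fix k assume "k \<noteq> n"
    have "1 / (1 + h k) - 1 / (1 + h n) = 1 / (1 + h n) * (h n - h k) * (1 / (1 + h k))"
      using h_nonneg[of k] h_nonneg[of n] by (simp add: divide_simps)
    also have "\<dots> \<le> 1 / (1 + h n) * \<bar>h k - h n\<bar> * 1"
      using h_nonneg[of k] h_nonneg[of n]
      by (intro mult_mono mult_left_mono) auto
    finally show "q n k * (1 / (1 + h k) - 1 / (1 + h n)) \<le> q n k * (1 / (1 + h n) * \<bar>h k - h n\<bar>)"
      using \<open>k \<noteq> n\<close> by (intro mult_left_mono q_nonneg) auto
  qed auto
  also have "\<dots> = (1 / (1 + h n)) * (\<Sum>k\<le>Suc n. q n k * \<bar>h k - h n\<bar>)"
    by (simp add: sum_distrib_left algebra_simps)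
  also have "\<dots> \<le> (1 / (1 + h n)) * C"
    using h_nonneg[of n] h_rate by (intro mult_left_mono) auto
  finally show ?thesis by (simp add: mult.commute)
qed

lemma eventually_h_ge: "\<exists>N. \<forall>n>N. K \<le> h n"
  using h_at_top unfolding filterlim_at_top eventually_sequentially
  by (meson less_imp_le)

subsection \<open>Comparison principle\<close>

text \<open>The barrier \<open>h n + C * t\<close> is a supersolution tending to infinity with \<open>n\<close>, so it forces
  a maximum over the infinite state space to be attained.\<close>

lemma comparison:
  assumes bdd: "\<And>t n. 0 \<le> t \<Longrightarrow> t \<le> T \<Longrightarrow> z t n \<le> B"
    and cont: "\<And>n. continuous_on {0..T} (\<lambda>t. z t n)"
    and z0: "\<And>n. z 0 n \<le> 0"
    and deriv: "\<And>t n. 0 < t \<Longrightarrow> t \<le> T \<Longrightarrow> 0 < z t n \<Longrightarrow>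
      \<exists>D \<le> gen (z t) n. ((\<lambda>s. z s n) has_real_derivative D) (at t within {0..})"
    and t: "0 \<le> t" "t \<le> T"
  shows "z t n \<le> 0"
proof (rule ccontr)
  assume "\<not> z t n \<le> 0"
  then have pos: "0 < z t n" by simp
  \<comment> \<open>The value of the barrier at the bad point. With \<open>e\<close> below,
    subtracting \<open>e * d\<close> removes only half of \<open>z t n\<close>, so the corrected
    function is still positive there.\<close>
  define d where "d = 1 + h n + (C + 1) * t"
  define e where "e = z t n / (2 * d)"
  have den: "0 < d"
    using h_nonneg[of n] C_nonneg t by (simp add: d_def add_pos_nonneg)
  then have e: "0 < e" using pos by (simp add: e_def)
  \<comment> \<open>The slope is \<open>C + 1\<close> rather than \<open>C\<close> so that the
    barrier is a strict supersolution: \<open>gen h \<le> C < C + 1\<close>.\<close>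
  define y where "y s k = z s k - e * (1 + h k + (C + 1) * s)" for s k
  have "y t n = z t n - e * d" by (simp add: y_def d_def)
  also have "\<dots> = z t n / 2" using den by (simp add: e_def)
  finally have "y t n = z t n / 2" .
  with pos have ypos: "0 < y t n" by simp
  have y_less: "y s k < z s k" if "0 \<le> s" for s k
    using e h_nonneg[of k] C_nonneg that by (simp add: y_def add_pos_nonneg)
  obtain N where N: "\<And>k. k > N \<Longrightarrow> B / e \<le> h k" using eventually_h_ge[of "B / e"] by blast
  have yneg: "y s k \<le> 0" if "k > N" "0 \<le> s" "s \<le> T" for s k
  proof -
    have "B \<le> e * h k" using N[OF that(1)] e by (simp add: field_simps)
    also have "\<dots> \<le> e * (1 + h k + (C + 1) * s)"
      using e C_nonneg that by (intro mult_left_mono) auto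
    finally show ?thesis using bdd[OF that(2,3), of k] by (simp add: y_def)
  qed
  \<comment> \<open>Maximise first over time in each state, by compactness, and then over the
    finitely many states up to \<open>max N n\<close>; beyond \<open>N\<close> the function is
    nonpositive.\<close>
  have "\<exists>s\<in>{0..T}. \<forall>r\<in>{0..T}. y r k \<le> y s k" for k
    unfolding y_def using t cont
    by (intro continuous_attains_sup) (auto intro!: continuous_intros)
  then obtain s where s: "\<And>k. s k \<in> {0..T}" "\<And>k r. r \<in> {0..T} \<Longrightarrow> y r k \<le> y (s k) k"
    by metis
  let ?Y = "(\<lambda>k. y (s k) k) ` {..max N n}"
  have "Max ?Y \<in> ?Y" by (rule Max_in) auto
  then obtain k where kM: "Max ?Y = y (s k) k" by blast
  have k: "y (s j) j \<le> y (s k) k" if "j \<le> max N n" for j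
    unfolding kM[symmetric] using that by (intro Max_ge) auto
  have ymax_pos: "0 < y (s k) k"
    using ypos s(2)[of t n] k[of n] t by auto
  have ymax: "y r j \<le> y (s k) k" if "r \<in> {0..T}" for r j
  proof (cases "j \<le> max N n")
    case True then show ?thesis using k[of j] s(2)[OF that, of j] by linarith
  next
    case False
    then have "y r j \<le> 0" using that by (intro yneg) auto
    then show ?thesis using ymax_pos by linarith
  qed
  have "s k \<noteq> 0"
    using z0[of k] y_less[of 0 k] ymax_pos by auto
  then have sk: "0 < s k" "s k \<le> T" using s(1)[of k] by auto
  with deriv[of "s k" k] ymax_pos y_less[of "s k" k]
  obtain D where D: "D \<le> gen (z (s k)) k" "((\<lambda>r. z r k) has_real_derivative D) (at (s k) within {0..})"
    by auto
  have "((\<lambda>r. y r k) has_real_derivative D - e * (C + 1)) (at (s k) within {0..})"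
    unfolding y_def by (auto intro!: derivative_eq_intros D)
  moreover have "D - e * (C + 1) < 0"
  proof -
    have "gen (y (s k)) k = gen (z (s k)) k - e * gen h k"
      unfolding y_def gen_simps by simp
    moreover have "gen (y (s k)) k \<le> 0"
      using ymax sk by (intro gen_nonpos_at_max) auto
    moreover have "e * gen h k \<le> e * C"
      using e gen_h_le by (intro mult_left_mono) auto
    ultimately show ?thesis using D(1) e unfolding distrib_left by linarith
  qed
  \<comment> \<open>A negative derivative at a maximum forces larger values at slightly earlier
    times. Looking to the left is possible because the maximising time is positive, and it also
    covers the endpoint \<open>T\<close>.\<close>
  ultimately obtain d where d: "d > 0" "\<And>r. r > 0 \<Longrightarrow> s k - r \<in> {0..} \<Longrightarrow> r < d \<Longrightarrow> y (s k) k < y (s k - r) k"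
    by (blast dest: has_real_derivative_neg_dec_left)
  define r where "r = min (d / 2) (s k)"
  have "y (s k) k < y (s k - r) k" using d(1) sk by (intro d(2)) (auto simp: r_def)
  moreover have "y (s k - r) k \<le> y (s k) k" using sk d(1) by (intro ymax) (auto simp: r_def)
  ultimately show False by simp
qed

subsection \<open>Bounded solutions of the backward equation\<close>

text \<open>The filter \<open>at t within {0..}\<close> makes the derivative one-sided at time 0 and
  the usual one at positive times.\<close>

definition solves :: "(nat \<Rightarrow> real) \<Rightarrow> (real \<Rightarrow> nat \<Rightarrow> real) \<Rightarrow> bool" where
  "solves f u \<longleftrightarrow> (\<exists>B. \<forall>t\<ge>0. \<forall>n. \<bar>u t n\<bar> \<le> B) \<and> u 0 = f \<and>
     (\<forall>t\<ge>0. \<forall>n. ((\<lambda>s. u s n) has_real_derivative gen (u t) n) (at t within {0..}))"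

text \<open>Apply \<open>comparison\<close> to \<open>u - v\<close>. As \<open>v\<close> is bounded
  below only, the growing barrier \<open>h n + C * t\<close> is admissible as a
  supersolution.\<close>

lemma solves_le_supersolution:
  assumes u: "solves f u"
    and v: "\<And>t n. 0 \<le> t \<Longrightarrow> ((\<lambda>s. v s n) has_real_derivative v' t n) (at t within {0..})"
    and super: "\<And>t n. 0 \<le> t \<Longrightarrow> gen (v t) n \<le> v' t n"
    and init: "\<And>n. f n \<le> v 0 n"
    and t: "0 \<le> t"
    and bdd: "\<And>s n. 0 \<le> s \<Longrightarrow> s \<le> t \<Longrightarrow> b \<le> v s n"
  shows "u t n \<le> v t n"
proof -
  obtain B where B: "\<And>t n. 0 \<le> t \<Longrightarrow> \<bar>u t n\<bar> \<le> B" using u by (auto simp: solves_def)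
  have du: "((\<lambda>s. u s n) has_real_derivative gen (u t) n) (at t within {0..})" if "0 \<le> t" for t n
    using u that by (auto simp: solves_def)
  have dz: "((\<lambda>s. u s n - v s n) has_real_derivative gen (u t) n - v' t n) (at t within {0..})"
    if "0 \<le> t" for t n
    using du[OF that] v[OF that] by (auto intro!: derivative_eq_intros)
  have "u t n - v t n \<le> 0"
  proof (rule comparison[where z = "\<lambda>t n. u t n - v t n" and T = t and B = "B - b"])
    show "u s k - v s k \<le> B - b" if "0 \<le> s" "s \<le> t" for s k
      using B[OF that(1), of k] bdd[OF that, of k] by linarith
    show "continuous_on {0..t} (\<lambda>s. u s k - v s k)" for k
    proof (rule continuous_on_subset)
      show "continuous_on {0..} (\<lambda>s. u s k - v s k)"
        by (rule DERIV_continuous_on[where D = "\<lambda>t. gen (u t) k - v' t k"]) (use dz in auto)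
    qed auto
    show "u 0 k - v 0 k \<le> 0" for k
      using u init by (auto simp: solves_def)
    show "\<exists>D\<le>gen (\<lambda>n. u s n - v s n) k. ((\<lambda>s. u s k - v s k) has_real_derivative D) (at s within {0..})"
      if "0 < s" for s k
      using dz[of s k] super[of s k] that by (intro exI[of _ "gen (u s) k - v' s k"]) (auto simp: gen_simps)
  qed (use t in auto)
  then show ?thesis by simp
qed

lemma solves_cmult: "solves f u \<Longrightarrow> solves (\<lambda>n. c * f n) (\<lambda>t n. c * u t n)"
proof -
  assume u: "solves f u"
  then obtain B where "\<And>t n. 0 \<le> t \<Longrightarrow> \<bar>u t n\<bar> \<le> B" by (auto simp: solves_def)
  then have "\<bar>c * u t n\<bar> \<le> \<bar>c\<bar> * B" if "0 \<le> t" for t n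
    using that by (simp add: abs_mult mult_left_mono)
  moreover have "((\<lambda>s. c * u s n) has_real_derivative gen (\<lambda>k. c * u t k) n) (at t within {0..})"
    if "0 \<le> t" for t n
    using u that unfolding gen_simps by (intro DERIV_cmult) (simp add: solves_def)
  ultimately show ?thesis using u unfolding solves_def by blast
qed

lemma solves_add: "solves f u \<Longrightarrow> solves g v \<Longrightarrow> solves (\<lambda>n. f n + g n) (\<lambda>t n. u t n + v t n)"
proof -
  assume u: "solves f u" and v: "solves g v"
  obtain B where B: "\<And>t n. 0 \<le> t \<Longrightarrow> \<bar>u t n\<bar> \<le> B" using u by (auto simp: solves_def)
  obtain B' where B': "\<And>t n. 0 \<le> t \<Longrightarrow> \<bar>v t n\<bar> \<le> B'" using v by (auto simp: solves_def)
  have "\<bar>u t n + v t n\<bar> \<le> B + B'" if "0 \<le> t" for t n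
    using B[OF that, of n] B'[OF that, of n] by linarith
  moreover have "((\<lambda>s. u s n + v s n) has_real_derivative gen (\<lambda>k. u t k + v t k) n) (at t within {0..})"
    if "0 \<le> t" for t n
    using u v that unfolding gen_simps by (intro DERIV_add) (simp_all add: solves_def)
  ultimately show ?thesis using u v unfolding solves_def by blast
qed

lemma solves_const: "solves (\<lambda>_. c) (\<lambda>_ _. c)"
  by (auto simp: solves_def gen_simps)

lemma solves_mono:
  assumes u: "solves f u" and v: "solves g v" and "\<And>n. f n \<le> g n" "0 \<le> t"
  shows "u t n \<le> v t n"
proof -
  obtain B where "\<And>t n. 0 \<le> t \<Longrightarrow> \<bar>v t n\<bar> \<le> B" using v by (auto simp: solves_def)
  then have B: "- B \<le> v t n" if "0 \<le> t" for t n
    using that by (metis abs_le_iff minus_le_iff)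
  show ?thesis
    by (rule solves_le_supersolution[OF u, of v "\<lambda>t. gen (v t)" t "- B"])
      (use v assms(3,4) B in \<open>auto simp: solves_def\<close>)
qed

lemma solves_unique: "solves f u \<Longrightarrow> solves f v \<Longrightarrow> 0 \<le> t \<Longrightarrow> u t = v t"
  using solves_mono[of f u f v t] solves_mono[of f v f u t] by (intro ext order.antisym) simp_all

section \<open>Truncated systems and their limit\<close>

definition trunc :: "nat \<Rightarrow> (nat \<Rightarrow> real) \<Rightarrow> nat \<Rightarrow> real" where
  "trunc N f n = (if n \<le> N then gen f n else 0)"

lemma trunc_le: "n \<le> N \<Longrightarrow> trunc N f n = gen f n"
  and trunc_gt: "N < n \<Longrightarrow> trunc N f n = 0"
  by (simp_all add: trunc_def)

text \<open>The exponential series of \<open>trunc N\<close>. Freezing all states above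
  \<open>N\<close> leaves finitely many nonzero rows, hence a bounded operator on bounded
  functions.\<close>

definition trunc_flow :: "nat \<Rightarrow> (nat \<Rightarrow> real) \<Rightarrow> real \<Rightarrow> nat \<Rightarrow> real" where
  "trunc_flow N f t n = (\<Sum>j. (trunc N ^^ j) f n / fact j * t ^ j)"

text \<open>A crude bound for the operator norm: row norms are summed instead of maximised.\<close>

definition trunc_norm :: "nat \<Rightarrow> real" where
  "trunc_norm N = (\<Sum>n\<le>N. \<Sum>k\<le>Suc n. \<bar>q n k\<bar>)"

lemma trunc_norm_nonneg: "0 \<le> trunc_norm N"
  by (simp add: trunc_norm_def sum_nonneg)

lemma trunc_power_bound:
  assumes f: "\<And>n. \<bar>f n\<bar> \<le> B"
  shows "\<bar>(trunc N ^^ j) f n\<bar> \<le> B * trunc_norm N ^ j"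
proof (induction j arbitrary: n)
  case 0 then show ?case using f by simp
next
  case (Suc j)
  let ?g = "(trunc N ^^ j) f" and ?c = "B * trunc_norm N ^ j"
  have c: "0 \<le> ?c" using Suc.IH[of 0] by linarith
  show ?case
  proof (cases "n \<le> N")
    case True
    have "\<bar>gen ?g n\<bar> \<le> (\<Sum>k\<le>Suc n. \<bar>q n k\<bar> * \<bar>?g k\<bar>)"
      unfolding gen_def by (rule order.trans[OF sum_abs]) (simp add: abs_mult)
    also have "\<dots> \<le> (\<Sum>k\<le>Suc n. \<bar>q n k\<bar> * ?c)"
      using Suc.IH by (intro sum_mono mult_left_mono) auto
    also have "\<dots> = (\<Sum>k\<le>Suc n. \<bar>q n k\<bar>) * ?c"
      by (simp only: sum_distrib_right)
    also have "\<dots> \<le> trunc_norm N * ?c"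
    proof (rule mult_right_mono[OF _ c])
      show "(\<Sum>k\<le>Suc n. \<bar>q n k\<bar>) \<le> trunc_norm N"
        unfolding trunc_norm_def using True
        by (intro member_le_sum[of n "{..N}" "\<lambda>n. \<Sum>k\<le>Suc n. \<bar>q n k\<bar>"]) (auto intro: sum_nonneg)
    qed
    finally show ?thesis using True by (simp add: trunc_le mult_ac)
  next
    case False
    then show ?thesis using mult_nonneg_nonneg[OF trunc_norm_nonneg c, of N] by (simp add: trunc_gt mult_ac)
  qed
qed

context
  fixes f :: "nat \<Rightarrow> real" and B :: real
  assumes f: "\<And>n. \<bar>f n\<bar> \<le> B"
begin

lemma trunc_term_bound:
  "norm ((trunc N ^^ j) f n / fact j * t ^ j) \<le> B * ((trunc_norm N * \<bar>t\<bar>) ^ j / fact j)"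
proof -
  have "norm ((trunc N ^^ j) f n / fact j * t ^ j) = \<bar>(trunc N ^^ j) f n\<bar> * (\<bar>t\<bar> ^ j / fact j)"
    by (simp add: abs_mult power_abs)
  also have "\<dots> \<le> (B * trunc_norm N ^ j) * (\<bar>t\<bar> ^ j / fact j)"
    by (intro mult_right_mono trunc_power_bound f) auto
  finally show ?thesis by (simp add: power_mult_distrib)
qed

lemma exp_terms_sums: "(\<lambda>j. B * ((trunc_norm N * \<bar>t\<bar>) ^ j / fact j)) sums (B * exp (trunc_norm N * \<bar>t\<bar>))"
  using exp_converges[of "trunc_norm N * \<bar>t\<bar>"] by (intro sums_mult) (simp add: field_simps)

lemma trunc_flow_summable: "summable (\<lambda>j. (trunc N ^^ j) f n / fact j * t ^ j)"
  by (rule summable_comparison_test'[OF sums_summable[OF exp_terms_sums] trunc_term_bound])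

lemma trunc_flow_bound_exp: "\<bar>trunc_flow N f t n\<bar> \<le> B * exp (trunc_norm N * \<bar>t\<bar>)"
proof -
  have "norm (\<Sum>j. (trunc N ^^ j) f n / fact j * t ^ j) \<le> (\<Sum>j. B * ((trunc_norm N * \<bar>t\<bar>) ^ j / fact j))"
    by (rule norm_suminf_le[OF trunc_term_bound sums_summable[OF exp_terms_sums]])
  then show ?thesis
    unfolding trunc_flow_def real_norm_def sums_unique[OF exp_terms_sums, symmetric] .
qed

lemma trunc_flow_0: "trunc_flow N f 0 n = f n"
  unfolding trunc_flow_def by (subst powser_zero) simp

lemma trunc_flow_deriv:
  "((\<lambda>s. trunc_flow N f s n) has_real_derivative trunc N (trunc_flow N f t) n) (at t within S)"
proof -
  let ?a = "\<lambda>n j. (trunc N ^^ j) f n / fact j"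
  have "((\<lambda>s. trunc_flow N f s n) has_real_derivative (\<Sum>j. diffs (?a n) j * t ^ j)) (at t)"
    unfolding trunc_flow_def by (rule termdiffs_strong_converges_everywhere[OF trunc_flow_summable])
  moreover have "(\<Sum>j. diffs (?a n) j * t ^ j) = trunc N (trunc_flow N f t) n"
  proof -
    have d: "diffs (?a n) j = trunc N ((trunc N ^^ j) f) n / fact j" for j
      by (simp add: diffs_def divide_simps del: of_nat_Suc)
    show ?thesis
    proof (cases "n \<le> N")
      case True
      have "diffs (?a n) j * t ^ j = (\<Sum>k\<le>Suc n. q n k * (?a k j * t ^ j))" for j
        unfolding d trunc_le[OF True] gen_def sum_divide_distrib sum_distrib_right
        by (rule sum.cong) simp_all
      then have "(\<Sum>j. diffs (?a n) j * t ^ j) = (\<Sum>j. \<Sum>k\<le>Suc n. q n k * (?a k j * t ^ j))"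
        by presburger
      also have "\<dots> = (\<Sum>k\<le>Suc n. \<Sum>j. q n k * (?a k j * t ^ j))"
        by (rule suminf_sum) (intro summable_mult trunc_flow_summable)
      also have "\<dots> = (\<Sum>k\<le>Suc n. q n k * trunc_flow N f t k)"
        unfolding trunc_flow_def by (intro sum.cong refl suminf_mult trunc_flow_summable)
      finally show ?thesis using True by (simp add: trunc_le gen_def)
    qed (simp add: d trunc_gt)
  qed
  ultimately show ?thesis by (simp add: has_field_derivative_at_within)
qed

lemma trunc_flow_beyond: "N < n \<Longrightarrow> trunc_flow N f t n = f n"
  using DERIV_isconst_all[of "\<lambda>s. trunc_flow N f s n" t 0] trunc_flow_deriv[of N n _ UNIV]
  by (simp add: trunc_flow_0 trunc_def)

lemma trunc_flow_continuous: "continuous_on S (\<lambda>s. trunc_flow N f s n)"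
  by (rule DERIV_continuous_on[OF trunc_flow_deriv])

text \<open>A frozen state keeps its initial value, so \<open>K\<close> can only be exceeded in a
  state up to \<open>N\<close>, where the derivative is the full \<open>gen\<close> and
  \<open>comparison\<close> applies. The exponential bound serves only to supply boundedness there.
  The factor \<open>c\<close> gives upper and lower bounds at once.\<close>

lemma trunc_flow_le:
  assumes "\<And>n. c * f n \<le> K" "0 \<le> t"
  shows "c * trunc_flow N f t n \<le> K"
proof -
  have "c * trunc_flow N f t n - K \<le> 0"
  proof (rule comparison[where z = "\<lambda>t n. c * trunc_flow N f t n - K" and T = t
        and B = "\<bar>c\<bar> * (B * exp (trunc_norm N * t)) - K"])
    fix s k assume s: "0 \<le> s" "s \<le> t"
    have "c * trunc_flow N f s k \<le> \<bar>c\<bar> * \<bar>trunc_flow N f s k\<bar>"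
      by (metis abs_ge_self abs_mult)
    also have "\<dots> \<le> \<bar>c\<bar> * (B * exp (trunc_norm N * \<bar>s\<bar>))"
      by (intro mult_left_mono trunc_flow_bound_exp) auto
    also have "\<dots> \<le> \<bar>c\<bar> * (B * exp (trunc_norm N * t))"
      using s trunc_norm_nonneg[of N] f[of 0] by (intro mult_left_mono) (auto intro: mult_left_mono)
    finally show "c * trunc_flow N f s k - K \<le> \<bar>c\<bar> * (B * exp (trunc_norm N * t)) - K" by simp
  next
    fix s k assume s: "0 < s" "s \<le> t" "0 < c * trunc_flow N f s k - K"
    then have "k \<le> N" using trunc_flow_beyond[of N k s] assms(1)[of k] by (metis linorder_not_less le_iff_diff_le_0)
    with trunc_flow_deriv[of N k s "{0..}"]
    show "\<exists>D\<le>gen (\<lambda>n. c * trunc_flow N f s n - K) k.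
        ((\<lambda>s. c * trunc_flow N f s k - K) has_real_derivative D) (at s within {0..})"
      by (intro exI[of _ "c * gen (trunc_flow N f s) k"])
        (auto intro!: derivative_eq_intros simp: trunc_def gen_simps)
  qed (use assms in \<open>auto intro!: continuous_intros trunc_flow_continuous simp: trunc_flow_0\<close>)
  then show ?thesis by simp
qed

lemma trunc_flow_bound: "0 \<le> t \<Longrightarrow> \<bar>trunc_flow N f t n\<bar> \<le> B"
  using trunc_flow_le[of 1 B t N n] trunc_flow_le[of "-1" B t N n] f by (simp add: abs_le_iff)

text \<open>Up to state \<open>N\<close> both truncations follow \<open>gen\<close>, so their
  difference solves the linear equation; beyond \<open>N\<close> the barrier already exceeds the
  trivial bound \<open>2 * B\<close>. Taking \<open>N\<close> large allows \<open>e\<close> to be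
  small.\<close>

lemma trunc_flow_diff_le:
  assumes e: "0 \<le> e" "\<And>n. N < n \<Longrightarrow> 1 \<le> e * h n" and M: "N \<le> M" "N \<le> M'" and t: "0 \<le> t"
  shows "trunc_flow M f t n - trunc_flow M' f t n \<le> 2 * B * e * (h n + C * t)"
proof -
  define z where "z t n = trunc_flow M f t n - trunc_flow M' f t n - 2 * B * e * (h n + C * t)" for t n
  have B: "0 \<le> B" using f[of 0] by linarith
  have "z t n \<le> 0"
  proof (rule comparison[where z = z and T = t and B = "2 * B"])
    fix s :: real and k assume s: "0 \<le> s"
    have "0 \<le> 2 * B * e * (h k + C * s)"
      using B e(1) h_nonneg[of k] C_nonneg s by (intro mult_nonneg_nonneg add_nonneg_nonneg) auto
    then show "z s k \<le> 2 * B"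
      using trunc_flow_bound[OF s, of M k] trunc_flow_bound[OF s, of M' k] by (simp add: z_def)
  next
    fix s k assume s: "0 < s" "s \<le> t" "0 < z s k"
    have "k \<le> N"
    proof (rule ccontr)
      assume "\<not> k \<le> N"
      then have "1 \<le> e * h k" using e by simp
      also have "\<dots> \<le> e * (h k + C * s)"
        using e(1) C_nonneg s by (intro mult_left_mono) auto
      finally have "2 * B * 1 \<le> 2 * B * (e * (h k + C * s))" using B by (intro mult_left_mono) auto
      then show False
        using s trunc_flow_bound[of s M k] trunc_flow_bound[of s M' k] by (simp add: z_def algebra_simps)
    qed
    then have M: "k \<le> M" "k \<le> M'" using M by auto
    have "((\<lambda>s. z s k) has_real_derivative gen (trunc_flow M f s) k - gen (trunc_flow M' f s) k - 2 * B * e * C)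
      (at s within {0..})"
      unfolding z_def using M
      by (auto intro!: derivative_eq_intros trunc_flow_deriv[THEN DERIV_cong] simp: trunc_def)
    moreover have "gen (trunc_flow M f s) k - gen (trunc_flow M' f s) k - 2 * B * e * C \<le> gen (z s) k"
      using mult_left_mono[OF gen_h_le[of k], of "2 * B * e"] B e(1)
      unfolding z_def gen_simps by (simp add: algebra_simps)
    ultimately show "\<exists>D\<le>gen (z s) k. ((\<lambda>s. z s k) has_real_derivative D) (at s within {0..})" by blast
  next
    show "continuous_on {0..t} (\<lambda>t. z t k)" for k
      unfolding z_def by (intro continuous_intros trunc_flow_continuous)
    show "z 0 k \<le> 0" for k
      using B e(1) h_nonneg[of k] by (simp add: z_def trunc_flow_0)
  qed (use t in auto)
  then show ?thesis by (simp add: z_def)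
qed

lemma trunc_flow_uniform_Cauchy:
  assumes "0 < e"
  obtains N where "\<And>M M' t. N \<le> M \<Longrightarrow> N \<le> M' \<Longrightarrow> 0 \<le> t \<Longrightarrow> t \<le> T \<Longrightarrow>
    \<bar>trunc_flow M f t n - trunc_flow M' f t n\<bar> < e"
proof -
  \<comment> \<open>Chosen so that the bound of \<open>trunc_flow_diff_le\<close> stays below
    \<open>e\<close> for all times up to \<open>T\<close>; the added ones keep the denominator
    positive and the inequality strict.\<close>
  define d where "d = e / ((2 * B + 1) * (h n + C * \<bar>T\<bar> + 1))"
  have B: "0 \<le> B" using f[of 0] by linarith
  have h: "0 \<le> h n + C * \<bar>T\<bar>" using h_nonneg[of n] C_nonneg by simp
  have d: "0 < d" using assms B h by (simp add: d_def)
  obtain N where N: "\<And>k. N < k \<Longrightarrow> 1 / d \<le> h k" using eventually_h_ge[of "1 / d"] by blast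
  have N': "1 \<le> d * h k" if "N < k" for k
    using N[OF that] d by (simp add: field_simps)
  have "trunc_flow M f t n - trunc_flow M' f t n < e" if "N \<le> M" "N \<le> M'" "0 \<le> t" "t \<le> T" for M M' t
  proof -
    have "trunc_flow M f t n - trunc_flow M' f t n \<le> 2 * B * d * (h n + C * t)"
      using d N' that by (intro trunc_flow_diff_le) auto
    also have "\<dots> \<le> 2 * B * d * (h n + C * \<bar>T\<bar>)"
      using B d C_nonneg that by (intro mult_left_mono) (auto intro!: mult_left_mono)
    also have "\<dots> \<le> (2 * B + 1) * d * (h n + C * \<bar>T\<bar>)"
      using d h by (intro mult_right_mono) auto
    also have "\<dots> < (2 * B + 1) * d * (h n + C * \<bar>T\<bar> + 1)"
      using B d by (intro mult_strict_left_mono) auto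
    also have "\<dots> = e" using B h by (simp add: d_def)
    finally show ?thesis .
  qed
  from this this[of _ _] show ?thesis
    by (intro that[of N]) (metis abs_less_iff minus_diff_eq)
qed

lemma trunc_flow_converges: "0 \<le> t \<Longrightarrow> convergent (\<lambda>N. trunc_flow N f t n)"
  unfolding Cauchy_convergent_iff[symmetric] Cauchy_def dist_real_def
  by (metis trunc_flow_uniform_Cauchy order.refl)

lemma trunc_flow_uniform_limit:
  "uniform_limit {0..T} (\<lambda>N t. trunc_flow N f t n) (\<lambda>t. lim (\<lambda>N. trunc_flow N f t n)) sequentially"
proof (rule uniformly_convergent_uniform_limit_iff[THEN iffD1])
  show "uniformly_convergent_on {0..T} (\<lambda>N t. trunc_flow N f t n)"
    by (rule Cauchy_uniformly_convergent, rule uniformly_Cauchy_onI)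
      (metis trunc_flow_uniform_Cauchy atLeastAtMost_iff dist_real_def)
qed

text \<open>Each row is a finite sum, so uniform convergence of the truncated flows on compact time
  intervals carries over to their derivatives, and the limit may be differentiated termwise.\<close>

lemma trunc_flow_lim_solves: "solves f (\<lambda>t n. lim (\<lambda>N. trunc_flow N f t n))" (is "solves f ?u")
  unfolding solves_def
proof (intro conjI allI impI exI)
  have lim: "(\<lambda>N. trunc_flow N f t n) \<longlonglongrightarrow> ?u t n" if "0 \<le> t" for t n
    using trunc_flow_converges[OF that] by (simp add: convergent_LIMSEQ_iff)
  show "\<bar>?u t n\<bar> \<le> B" if "0 \<le> t" for t n
    using that by (intro LIMSEQ_le_const2[OF tendsto_rabs[OF lim]]) (auto intro: trunc_flow_bound)
  show "?u 0 = f" by (simp add: trunc_flow_0 fun_eq_iff)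
  fix t :: real and n assume t: "0 \<le> t"
  \<comment> \<open>The interval extends past \<open>t\<close>, so that \<open>t\<close> is not its
    right endpoint and the filter agrees with \<open>at t within {0..}\<close>.\<close>
  let ?S = "{0..t+1}"
  have gen_lim: "uniform_limit ?S (\<lambda>N t. trunc N (trunc_flow N f t) n) (\<lambda>t. gen (?u t) n) sequentially"
  proof (rule uniform_limit_cong[THEN iffD1, rotated 2])
    show "uniform_limit ?S (\<lambda>N t. \<Sum>k\<le>Suc n. q n k * trunc_flow N f t k) (\<lambda>t. \<Sum>k\<le>Suc n. q n k * ?u t k) sequentially"
    proof (rule uniform_limit_sum)
      show "uniform_limit ?S (\<lambda>N t. q n k * trunc_flow N f t k) (\<lambda>t. q n k * ?u t k) sequentially" for k
        by (rule bounded_linear.uniform_limit[OF bounded_linear_mult_right trunc_flow_uniform_limit])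
    qed
    show "\<forall>\<^sub>F N in sequentially. \<forall>t\<in>?S. (\<Sum>k\<le>Suc n. q n k * trunc_flow N f t k) = trunc N (trunc_flow N f t) n"
      using eventually_ge_at_top[of n] by eventually_elim (simp add: trunc_def gen_def)
  qed (simp add: gen_def)
  have "\<exists>g. \<forall>x\<in>?S. (\<lambda>N. trunc_flow N f x n) \<longlonglongrightarrow> g x \<and> (g has_derivative (*) (gen (?u x) n)) (at x within ?S)"
  proof (rule has_derivative_sequence)
    show "((\<lambda>s. trunc_flow N f s n) has_derivative (*) (trunc N (trunc_flow N f x) n)) (at x within ?S)" for N x
      using trunc_flow_deriv by (simp add: has_field_derivative_def)
    show "\<forall>\<^sub>F N in sequentially. \<forall>x\<in>?S. \<forall>d. norm (trunc N (trunc_flow N f x) n * d - gen (?u x) n * d) \<le> e * norm d"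
      if "0 < e" for e
      using uniform_limitD[OF gen_lim that]
      by eventually_elim
        (metis dist_real_def left_diff_distrib less_imp_le mult_right_mono norm_ge_zero norm_mult real_norm_def)
    show "0 \<in> ?S" using t by simp
    show "(\<lambda>N. trunc_flow N f 0 n) \<longlonglongrightarrow> f n" by (simp add: trunc_flow_0)
  qed simp
  then obtain g where g: "\<forall>x\<in>?S. (\<lambda>N. trunc_flow N f x n) \<longlonglongrightarrow> g x \<and>
      (g has_derivative (*) (gen (?u x) n)) (at x within ?S)" ..
  have "((\<lambda>s. ?u s n) has_real_derivative gen (?u t) n) (at t within ?S)"
  proof (rule has_field_derivative_transform_within[of g _ _ _ 1])
    show "(g has_real_derivative gen (?u t) n) (at t within ?S)"
      using bspec[OF g, of t] t by (simp add: has_field_derivative_def)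
    show "g x = ?u x n" if "x \<in> ?S" for x
      using limI[of "\<lambda>N. trunc_flow N f x n" "g x"] bspec[OF g that] by simp
  qed (use t in auto)
  moreover have "at t within ?S = at t within {0..}"
    using t by (intro at_within_nhd[of t "{..<t+1}"]) auto
  ultimately show "((\<lambda>s. ?u s n) has_real_derivative gen (?u t) n) (at t within {0..})" by simp
qed

end

section \<open>The semigroup of bounded solutions\<close>

definition flow :: "(nat \<Rightarrow> real) \<Rightarrow> real \<Rightarrow> nat \<Rightarrow> real" where
  "flow f = (\<lambda>t n. lim (\<lambda>N. trunc_flow N f t n))"

lemma solves_flow: "f \<in> Cb \<Longrightarrow> solves f (flow f)"
  unfolding Cb_def bounded_iff flow_def by (auto intro: trunc_flow_lim_solves)

text \<open>Uniqueness in usable form: linearity, the semigroup law and self-similarity all follow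
  by exhibiting a bounded solution with the right initial value.\<close>

lemma flow_eq: "solves f u \<Longrightarrow> 0 \<le> t \<Longrightarrow> flow f t = u t"
proof -
  assume u: "solves f u" "0 \<le> t"
  then have "f \<in> Cb" unfolding solves_def by (metis CbI order.refl)
  then show ?thesis using solves_unique[OF solves_flow] u by blast
qed

lemma flow_0: "f \<in> Cb \<Longrightarrow> flow f 0 = f"
  using solves_flow by (simp add: solves_def)

lemma flow_const: "0 \<le> t \<Longrightarrow> flow (\<lambda>_. c) t n = c"
  using flow_eq[OF solves_const] by simp

lemma flow_cmult: "f \<in> Cb \<Longrightarrow> 0 \<le> t \<Longrightarrow> flow (\<lambda>n. c * f n) t n = c * flow f t n"
  using flow_eq[OF solves_cmult[OF solves_flow]] by simp

lemma flow_add: "f \<in> Cb \<Longrightarrow> g \<in> Cb \<Longrightarrow> 0 \<le> t \<Longrightarrow> flow (\<lambda>n. f n + g n) t n = flow f t n + flow g t n"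
  using flow_eq[OF solves_add[OF solves_flow solves_flow]] by simp

lemma flow_mono: "f \<in> Cb \<Longrightarrow> g \<in> Cb \<Longrightarrow> (\<And>n. f n \<le> g n) \<Longrightarrow> 0 \<le> t \<Longrightarrow> flow f t n \<le> flow g t n"
  by (rule solves_mono[OF solves_flow solves_flow])

lemma flow_bound:
  assumes "\<And>n. \<bar>f n\<bar> \<le> B" "0 \<le> t" shows "\<bar>flow f t n\<bar> \<le> B"
proof -
  have "f \<in> Cb" "(\<lambda>_. B) \<in> Cb" "(\<lambda>_. - B) \<in> Cb" using assms by (auto intro: CbI)
  then show ?thesis
    using flow_mono[of f "\<lambda>_. B" t n] flow_mono[of "\<lambda>_. - B" f t n] assms
    by (simp add: flow_const abs_le_iff) (metis abs_le_iff minus_le_iff)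
qed

lemma flow_in_Cb: "f \<in> Cb \<Longrightarrow> 0 \<le> t \<Longrightarrow> flow f t \<in> Cb"
  using CbD[of f] by (metis CbI flow_bound)

lemma flow_nonneg: "f \<in> Cb \<Longrightarrow> (\<And>n. 0 \<le> f n) \<Longrightarrow> 0 \<le> t \<Longrightarrow> 0 \<le> flow f t n"
  using flow_mono[of "\<lambda>_. 0" f t n] by (simp add: flow_const CbI[of _ 0])

lemma flow_diff: "f \<in> Cb \<Longrightarrow> g \<in> Cb \<Longrightarrow> 0 \<le> t \<Longrightarrow> flow (\<lambda>n. f n - g n) t n = flow f t n - flow g t n"
  using flow_add[of f "\<lambda>n. - 1 * g n" t n] flow_cmult[of g t "-1" n] Cb_cmult[of g "-1"] by simp

lemma flow_deriv:
  "f \<in> Cb \<Longrightarrow> 0 \<le> t \<Longrightarrow> ((\<lambda>s. flow f s n) has_real_derivative gen (flow f t) n) (at t within {0..})"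
  using solves_flow by (simp add: solves_def)

text \<open>The equation is autonomous, so a time-shifted solution is again a solution, now started
  from \<open>flow f t\<close>.\<close>

lemma flow_add_time:
  assumes f: "f \<in> Cb" and st: "0 \<le> s" "0 \<le> t"
  shows "flow f (s + t) = flow (flow f t) s"
proof -
  have "solves (flow f t) (\<lambda>s. flow f (s + t))"
    unfolding solves_def
  proof (intro conjI allI impI)
    obtain B where B: "\<And>n. \<bar>f n\<bar> \<le> B" using CbD[OF f] by blast
    show "\<exists>B. \<forall>s\<ge>0. \<forall>n. \<bar>flow f (s + t) n\<bar> \<le> B"
      using flow_bound[OF B] st by (intro exI[of _ B]) auto
    fix s :: real and n assume s: "0 \<le> s"
    have "((\<lambda>r. flow f r n) \<circ> (\<lambda>r. r + t) has_real_derivative gen (flow f (s + t)) n * 1) (at s within {0..})"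
    proof (rule DERIV_image_chain)
      show "((\<lambda>r. flow f r n) has_real_derivative gen (flow f (s + t)) n) (at (s + t) within (\<lambda>r. r + t) ` {0..})"
        by (rule DERIV_subset[OF flow_deriv[OF f]]) (use s st in auto)
    qed (auto intro!: derivative_eq_intros)
    then show "((\<lambda>r. flow f (r + t) n) has_real_derivative gen (flow f (s + t)) n) (at s within {0..})"
      by (simp add: o_def)
  qed simp
  from flow_eq[OF this st(1)] show ?thesis by simp
qed

section \<open>Transition probabilities\<close>

definition dirac :: "nat \<Rightarrow> nat \<Rightarrow> real" where
  "dirac k j = of_bool (j = k)"

lemma dirac_in_Cb: "dirac k \<in> Cb"
  by (rule CbI[of _ 1]) (simp add: dirac_def)

text \<open>Countable additivity of the kernel. Beyond \<open>N\<close> the tail of \<open>f\<close>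
  is dominated by \<open>B * e * h\<close>, and the barrier keeps the image of the tail small. With
  \<open>f\<close> constant this says that no mass escapes to infinity.\<close>

lemma flow_sums:
  assumes f: "f \<in> Cb" and t: "0 \<le> t"
  shows "(\<lambda>k. flow (dirac k) t n * f k) sums flow f t n"
proof -
  obtain B where B: "0 \<le> B" "\<And>n. \<bar>f n\<bar> \<le> B" using CbD[OF f] by blast
  define cut where "cut K j = (if j < K then f j else 0)" for K j
  have cut: "cut K \<in> Cb" for K
    using B by (intro CbI[of _ B]) (auto simp: cut_def)
  have partial: "(\<Sum>k<K. flow (dirac k) t n * f k) = flow (cut K) t n" for K
  proof (induction K)
    case 0 then show ?case using t flow_const[of t 0 n] by (simp add: cut_def)
  next
    case (Suc K)
    have "cut (Suc K) = (\<lambda>j. cut K j + f K * dirac K j)"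
      by (auto simp: cut_def dirac_def fun_eq_iff less_Suc_eq)
    then show ?case
      using Suc t by (simp add: flow_add flow_cmult cut dirac_in_Cb Cb_cmult mult.commute)
  qed
  have "(\<lambda>K. flow (cut K) t n) \<longlonglongrightarrow> flow f t n"
  proof (rule LIMSEQ_I)
    fix r :: real assume r: "0 < r"
    \<comment> \<open>Makes the barrier value \<open>B * e * (h n + C * t)\<close> smaller than
      \<open>r\<close>.\<close>
    define e where "e = r / (B * (h n + C * t) + 1)"
    have den: "0 \<le> B * (h n + C * t)" using B h_nonneg[of n] C_nonneg t by auto
    then have e: "0 < e" using r by (simp add: e_def)
    obtain N where N: "\<And>k. N < k \<Longrightarrow> 1 / e \<le> h k" using eventually_h_ge[of "1 / e"] by blast
    have lt: "B * e * (h n + C * t) < r"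
    proof -
      have "B * e * (h n + C * t) < (B * (h n + C * t) + 1) * e" using e by (simp add: algebra_simps)
      also have "\<dots> = r" using den by (simp add: e_def)
      finally show ?thesis .
    qed
    have tail: "flow (\<lambda>j. c * (f j - cut K j)) t n \<le> B * e * (h n + C * t)"
      if K: "N < K" and c: "\<bar>c\<bar> = 1" for c K
    proof (rule solves_le_supersolution[OF solves_flow, of "\<lambda>j. c * (f j - cut K j)" "\<lambda>t n. B * e * (h n + C * t)" "\<lambda>_ _. B * e * C" t 0])
      show "(\<lambda>j. c * (f j - cut K j)) \<in> Cb"
        using B by (intro CbI[of _ B]) (auto simp: cut_def abs_mult c)
      show "((\<lambda>s. B * e * (h k + C * s)) has_real_derivative B * e * C) (at s within {0..})" for s k
        by (auto intro!: derivative_eq_intros)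
      show "gen (\<lambda>k. B * e * (h k + C * s)) k \<le> B * e * C" for s k
        using mult_left_mono[OF gen_h_le[of k], of "B * e"] B e unfolding gen_simps by simp
      show "c * (f k - cut K k) \<le> B * e * (h k + C * 0)" for k
      proof (cases "k < K")
        case True then show ?thesis using B e h_nonneg[of k] by (simp add: cut_def)
      next
        case False
        then have "1 \<le> e * h k" using N[of k] K e by (simp add: field_simps)
        then have "B * 1 \<le> B * (e * h k)" using B by (intro mult_left_mono) auto
        moreover have "c * f k \<le> \<bar>c * f k\<bar>" by (rule abs_ge_self)
        then have "c * f k \<le> B" using B(2)[of k] c by (simp add: abs_mult)
        ultimately show ?thesis using False by (simp add: cut_def mult_ac)
      qed
      show "0 \<le> B * e * (h k + C * s)" if "0 \<le> s" for s k
        using B e h_nonneg[of k] C_nonneg that by (intro mult_nonneg_nonneg add_nonneg_nonneg) auto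
    qed (use t in auto)
    have "norm (flow (cut K) t n - flow f t n) < r" if "Suc N \<le> K" for K
      using tail[of K 1] tail[of K "-1"] that lt cut f t flow_diff[of f "cut K" t n] flow_diff[of "cut K" f t n]
      by (simp add: abs_less_iff)
    then show "\<exists>N. \<forall>K\<ge>N. norm (flow (cut K) t n - flow f t n) < r" by blast
  qed
  then show ?thesis by (simp add: sums_def partial)
qed

text \<open>Only times \<open>t \<ge> 0\<close> carry information: elsewhere the argument need not
  be a mass function.\<close>

definition chain :: "real \<Rightarrow> nat \<Rightarrow> nat pmf" where
  "chain t n = embed_pmf (\<lambda>k. flow (dirac k) t n)"

lemma pmf_chain:
  assumes "0 \<le> t" shows "pmf (chain t n) k = flow (dirac k) t n"
  unfolding chain_def
proof (rule pmf_embed_pmf)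
  show nonneg: "0 \<le> flow (dirac k) t n" for k
    using assms by (intro flow_nonneg dirac_in_Cb) (auto simp: dirac_def)
  have "(\<lambda>k. flow (dirac k) t n) sums 1"
    using flow_sums[of "\<lambda>_. 1" t n] assms by (simp add: flow_const CbI[of _ 1])
  then show "(\<integral>\<^sup>+k. ennreal (flow (dirac k) t n) \<partial>count_space UNIV) = 1"
    using nonneg by (simp add: nn_integral_count_space_nat suminf_ennreal_eq sums_iff)
qed

lemma semigroup_of_chain:
  assumes "f \<in> Cb" "0 \<le> t" shows "semigroup_of chain t f = flow f t"
proof
  fix n
  show "semigroup_of chain t f n = flow f t n"
    using sums_unique2[OF expectation_pmf_nat_sums[OF assms(1), of "chain t n"]] flow_sums[OF assms, of n] assms(2)
    by (simp add: semigroup_of_def pmf_chain)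
qed

lemma markov_chain: "markov_chain chain"
  unfolding markov_chain_def
proof (intro conjI allI impI)
  show "chain 0 n = return_pmf n" for n
    by (rule pmf_eqI) (auto simp: pmf_chain flow_0 dirac_in_Cb, auto simp: dirac_def indicator_def)
  fix s t :: real and n assume st: "0 \<le> s" "0 \<le> t"
  show "chain (s + t) n = bind_pmf (chain s n) (chain t)"
  proof (rule pmf_eqI)
    fix k
    have "pmf (bind_pmf (chain s n) (chain t)) k = semigroup_of chain s (flow (dirac k) t) n"
      using st by (simp add: pmf_bind pmf_chain semigroup_of_def)
    also have "\<dots> = flow (dirac k) (s + t) n"
      using st by (simp add: semigroup_of_chain flow_add_time flow_in_Cb dirac_in_Cb)
    finally show "pmf (chain (s + t) n) k = pmf (bind_pmf (chain s n) (chain t)) k"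
      using st by (simp add: pmf_chain)
  qed
qed

subsection \<open>The Feller property\<close>

text \<open>By \<open>gen_inverse_h_le\<close> the weight times \<open>exp (C * t)\<close> is a
  supersolution, and a constant may be added since \<open>gen\<close> annihilates it.\<close>

lemma flow_le_weight:
  assumes f: "f \<in> Cb" "\<And>n. f n \<le> a + M * (1 / (1 + h n))" and M: "0 \<le> M" and t: "0 \<le> t"
  shows "flow f t n \<le> a + M * exp (C * t) * (1 / (1 + h n))"
proof (rule solves_le_supersolution[OF solves_flow[OF f(1)], of "\<lambda>t n. a + M * exp (C * t) * (1 / (1 + h n))"
      "\<lambda>t n. M * (C * exp (C * t)) * (1 / (1 + h n))" t a])
  show "((\<lambda>s. a + M * exp (C * s) * (1 / (1 + h k))) has_real_derivative M * (C * exp (C * s)) * (1 / (1 + h k)))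
      (at s within {0..})" for s k
    using h_nonneg[of k] by (auto intro!: derivative_eq_intros)
  show "gen (\<lambda>k. a + M * exp (C * s) * (1 / (1 + h k))) k \<le> M * (C * exp (C * s)) * (1 / (1 + h k))" for s k
    using mult_left_mono[OF gen_inverse_h_le[of k], of "M * exp (C * s)"] M
    unfolding gen_simps by (simp add: mult_ac)
  show "a \<le> a + M * exp (C * s) * (1 / (1 + h k))" for s k
    using M h_nonneg[of k] by simp
qed (use f t in auto)

text \<open>Up to \<open>r / 2\<close>, a function vanishing at infinity is dominated by a multiple
  of the weight \<open>1 / (1 + h n)\<close>, which the flow preserves up to the factor
  \<open>exp (C * t)\<close> and which tends to 0.\<close>

lemma flow_in_C0:
  assumes f: "f \<in> C0" and t: "0 \<le> t" shows "flow f t \<in> C0"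
  unfolding C0_def mem_Collect_eq
proof (rule LIMSEQ_I)
  fix r :: real assume r: "0 < r"
  obtain K where K: "\<And>n. K \<le> n \<Longrightarrow> \<bar>f n\<bar> < r / 2" using C0E[OF f] r by (metis half_gt_zero)
  define M where "M = (\<Sum>k<K. \<bar>f k\<bar> * (1 + h k))"
  have M: "0 \<le> M" using h_nonneg by (auto simp: M_def intro!: sum_nonneg)
  have fM: "\<bar>f n\<bar> \<le> r / 2 + M * (1 / (1 + h n))" for n
  proof (cases "n < K")
    case True
    then have "\<bar>f n\<bar> * (1 + h n) \<le> M"
      unfolding M_def using h_nonneg by (intro member_le_sum[of n "{..<K}" "\<lambda>n. \<bar>f n\<bar> * (1 + h n)"]) auto
    then have "\<bar>f n\<bar> \<le> M * (1 / (1 + h n))" using h_nonneg[of n] by (simp add: field_simps)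
    then show ?thesis using r by simp
  next
    case False
    moreover have "0 \<le> M * (1 / (1 + h n))" using M h_nonneg[of n] by simp
    ultimately show ?thesis using K[of n] by simp
  qed
  have fCb: "f \<in> Cb" using f C0_subset_Cb by blast
  \<comment> \<open>From the level \<open>h n \<ge> L\<close> on, the weighted term lies below
    \<open>r / 2\<close>.\<close>
  define L where "L = 2 * M * exp (C * t) / r"
  obtain N where N: "\<And>k. N < k \<Longrightarrow> L \<le> h k" using eventually_h_ge[of L] by blast
  have "norm (flow f t n - 0) < r" if n: "Suc N \<le> n" for n
  proof -
    have "flow (\<lambda>n. c * f n) t n \<le> r / 2 + M * exp (C * t) * (1 / (1 + h n))" if "\<bar>c\<bar> = 1" for c
    proof (rule flow_le_weight[OF Cb_cmult[OF fCb] _ M t])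
      show "c * f n \<le> r / 2 + M * (1 / (1 + h n))" for n
        using fM[of n] abs_ge_self[of "c * f n"] that by (simp add: abs_mult)
    qed
    from this[of 1] this[of "-1"] have "\<bar>flow f t n\<bar> \<le> r / 2 + M * exp (C * t) * (1 / (1 + h n))"
      by (simp only: flow_cmult fCb t) (simp add: abs_le_iff)
    also have "M * exp (C * t) * (1 / (1 + h n)) < r / 2"
      using N[of n] n h_nonneg[of n] r M by (simp add: L_def field_simps add_strict_increasing2)
    finally show ?thesis by simp
  qed
  then show "\<exists>N. \<forall>n\<ge>N. norm (flow f t n - 0) < r" by blast
qed

text \<open>Far out, the row sum covers the whole support of \<open>f\<close>, so the image is a
  fixed finite combination of columns, each tending to 0.\<close>

lemma gen_in_C0:
  assumes "f \<in> Cc" shows "gen f \<in> C0"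
proof -
  obtain K where "{n. f n \<noteq> 0} \<subseteq> {..<K}" using assms by (auto simp: Cc_def finite_nat_iff_bounded)
  then have K: "f k \<noteq> 0 \<Longrightarrow> k < K" for k by (auto simp: subset_eq)
  have "(\<lambda>n. \<Sum>k<K. q n k * f k) \<longlonglongrightarrow> (\<Sum>k<K. 0 * f k)"
    by (intro tendsto_intros column_tendsto_0)
  moreover have "\<forall>\<^sub>F n in sequentially. (\<Sum>k<K. q n k * f k) = gen f n"
    using eventually_ge_at_top[of K]
    by eventually_elim (auto simp: gen_def simp del: sum.atMost_Suc intro!: sum.mono_neutral_left dest: K)
  ultimately show ?thesis
    by (auto simp: C0_def intro: Lim_transform_eventually)
qed

text \<open>A second-order comparison: approximating \<open>gen f\<close> by a function \<open>g\<close> with bounded image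
  yields the derivative at time 0 without differentiating the semigroup twice.\<close>

lemma flow_le_second_order:
  assumes f: "f \<in> Cb" and g: "g \<in> Cb" and e: "\<And>n. gen f n \<le> g n + e" "0 \<le> e"
    and M: "\<And>n. gen g n \<le> M" "0 \<le> M" and t: "0 \<le> t"
  shows "flow f t n \<le> f n + t * g n + e * t + M * t\<^sup>2"
proof -
  obtain F where F: "0 \<le> F" "\<And>n. \<bar>f n\<bar> \<le> F" using CbD[OF f] by blast
  obtain G where G: "0 \<le> G" "\<And>n. \<bar>g n\<bar> \<le> G" using CbD[OF g] by blast
  show ?thesis
  proof (rule solves_le_supersolution[OF solves_flow[OF f], of "\<lambda>t n. f n + t * g n + e * t + M * t\<^sup>2"
        "\<lambda>t n. g n + e + 2 * M * t" t "- F - t * G"])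
    show "((\<lambda>s. f k + s * g k + e * s + M * s\<^sup>2) has_real_derivative g k + e + 2 * M * s) (at s within {0..})" for s k
      by (auto intro!: derivative_eq_intros)
    \<comment> \<open>Applying \<open>gen\<close> to \<open>s * g\<close> costs at most
      \<open>M * s\<close>, which the time derivative \<open>2 * M * s\<close> of the quadratic term
      absorbs.\<close>
    show "gen (\<lambda>k. f k + s * g k + e * s + M * s\<^sup>2) k \<le> g k + e + 2 * M * s" if "0 \<le> s" for s k
      using e(1)[of k] mult_left_mono[OF M(1)[of k] that] mult_nonneg_nonneg[OF M(2) that]
      unfolding gen_simps by (simp add: algebra_simps)
    fix s k assume s: "0 \<le> s" "s \<le> t"
    have "- (t * G) \<le> s * g k"
    proof -
      have "\<bar>s * g k\<bar> \<le> t * G" using s G by (auto simp: abs_mult intro!: mult_mono)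
      then show ?thesis by linarith
    qed
    moreover have "- F \<le> f k" using F(2)[of k] by linarith
    moreover have "0 \<le> e * s" "0 \<le> M * s\<^sup>2" using e M s by auto
    ultimately show "- F - t * G \<le> f k + s * g k + e * s + M * s\<^sup>2" by linarith
  qed (use t in auto)
qed

lemma flow_second_order:
  assumes f: "f \<in> Cb" and g: "g \<in> Cb" and e: "\<And>n. \<bar>gen f n - g n\<bar> \<le> e"
    and M: "\<And>n. \<bar>gen g n\<bar> \<le> M" and t: "0 \<le> t"
  shows "\<bar>flow f t n - f n - t * g n\<bar> \<le> e * t + M * t\<^sup>2"
proof -
  have "0 \<le> e" "0 \<le> M" using e[of 0] M[of 0] by linarith+
  have "flow (\<lambda>n. c * f n) t n \<le> c * f n + t * (c * g n) + e * t + M * t\<^sup>2" if c: "c = 1 \<or> c = - 1" for c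
  proof (rule flow_le_second_order)
    show "gen (\<lambda>n. c * f n) n \<le> c * g n + e" for n
      using e[of n] c unfolding gen_simps by auto
    show "gen (\<lambda>n. c * g n) n \<le> M" for n
      using M[of n] c unfolding gen_simps by auto
  qed (use f g t \<open>0 \<le> e\<close> \<open>0 \<le> M\<close> in \<open>auto intro: Cb_cmult\<close>)
  from this[of 1] this[of "-1"] show ?thesis
    by (simp only: flow_cmult f t) (simp add: abs_le_iff)
qed

lemma flow_minus_id_bound:
  assumes "f \<in> Cb" "\<And>n. \<bar>gen f n\<bar> \<le> M" "0 \<le> t"
  shows "\<bar>flow f t n - f n\<bar> \<le> M * t"
  using flow_second_order[of f "\<lambda>_. 0" M 0 t n] assms CbI[of "\<lambda>_. 0" 0] by (simp add: gen_const)

text \<open>On \<open>Cc\<close> the flow moves at bounded speed because \<open>gen g\<close> is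
  bounded; density of \<open>Cc\<close> in \<open>C0\<close> and contractivity give the
  rest.\<close>

lemma flow_strongly_continuous:
  assumes f: "f \<in> C0"
  shows "uniform_limit UNIV (flow f) f (at_right 0)"
proof (rule uniform_limitI)
  fix r :: real assume r: "0 < r"
  have fCb: "f \<in> Cb" using f C0_subset_Cb by blast
  obtain g where g: "g \<in> Cc" "\<And>n. \<bar>f n - g n\<bar> \<le> r / 3" using C0_approx_Cc[OF f, of "r / 3"] r by auto
  have gCb: "g \<in> Cb" using g Cc_subset_C0 C0_subset_Cb by blast
  have "gen g \<in> Cb" using gen_in_C0[OF g(1)] C0_subset_Cb by blast
  then obtain M where M: "0 \<le> M" "\<And>n. \<bar>gen g n\<bar> \<le> M" using CbD by blast
  have "\<forall>\<^sub>F t in at_right 0. t < r / (3 * (M + 1))"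
    using r M by (intro eventually_at_right_less[THEN eventually_mono, of 0] order_tendstoD[of "\<lambda>t. t" 0]) (auto intro: tendsto_ident_at)
  then show "\<forall>\<^sub>F t in at_right 0. \<forall>n\<in>UNIV. dist (flow f t n) (f n) < r"
    using eventually_at_right_less[of 0]
  proof eventually_elim
    case (elim t)
    show ?case
    proof
      fix n
      have "M * t < r / 3"
      proof -
        have "M * t \<le> (M + 1) * t" using elim by simp
        also have "\<dots> < (M + 1) * (r / (3 * (M + 1)))" using elim M by (intro mult_strict_left_mono) auto
        also have "\<dots> = r / 3" using M by (simp add: field_simps)
        finally show ?thesis .
      qed
      moreover have "\<bar>flow g t n - g n\<bar> \<le> M * t"
        using elim by (intro flow_minus_id_bound gCb M) auto
      moreover have "\<bar>flow f t n - flow g t n\<bar> \<le> r / 3"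
        using flow_bound[of "\<lambda>n. f n - g n" "r / 3" t n, OF g(2)] elim flow_diff[OF fCb gCb, of t n] by simp
      ultimately show "dist (flow f t n) (f n) < r"
        using g(2)[of n] unfolding dist_real_def by linarith
    qed
  qed
qed

lemma feller_chain: "feller_chain chain"
  unfolding feller_chain_def
proof (intro conjI allI impI ballI)
  show "markov_chain chain" by (rule markov_chain)
  show "semigroup_of chain t f \<in> C0" if "0 \<le> t" "f \<in> C0" for t f
    using that C0_subset_Cb by (subst semigroup_of_chain) (auto intro: flow_in_C0)
  show "uniform_limit UNIV (\<lambda>t. semigroup_of chain t f) f (at_right 0)" if "f \<in> C0" for f
  proof (rule uniform_limit_cong[THEN iffD1, OF _ refl flow_strongly_continuous[OF that]])
    show "\<forall>\<^sub>F t in at_right 0. \<forall>x\<in>UNIV. flow f t x = semigroup_of chain t f x"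
      using eventually_at_right_less[of 0]
      by eventually_elim (use that C0_subset_Cb in \<open>auto simp: semigroup_of_chain\<close>)
  qed
  show "0 \<le> semigroup_of chain t f n" if "0 \<le> t" "f \<in> C0" "\<forall>n. 0 \<le> f n" for t f n
    using that by (simp add: semigroup_of_def)
  show "(SUP n. \<bar>semigroup_of chain t f n\<bar>) \<le> (SUP n. \<bar>f n\<bar>)" if "0 \<le> t" "f \<in> C0" for t f
  proof (rule cSUP_least)
    have f: "f \<in> Cb" using that C0_subset_Cb by blast
    then obtain B where "\<And>n. \<bar>f n\<bar> \<le> B" using CbD by blast
    then have "bdd_above (range (\<lambda>n. \<bar>f n\<bar>))" by (intro bdd_aboveI2[of _ _ B])
    then have "\<bar>f n\<bar> \<le> (SUP n. \<bar>f n\<bar>)" for n by (intro cSUP_upper) auto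
    then show "\<bar>semigroup_of chain t f n\<bar> \<le> (SUP n. \<bar>f n\<bar>)" for n
      using f that by (simp add: semigroup_of_chain flow_bound)
  qed simp
  show "semigroup_of chain t (\<lambda>_. 1) n = 1" for t n
    by (simp add: semigroup_of_def)
qed

subsection \<open>The generator and its core\<close>

definition cutoff :: "nat \<Rightarrow> nat \<Rightarrow> real" where
  "cutoff j n = max 0 (1 - h n / real (Suc j))"

lemma cutoff_bounds: "0 \<le> cutoff j n" "cutoff j n \<le> 1"
  using h_nonneg[of n] by (auto simp: cutoff_def)

lemma cutoff_diff: "\<bar>cutoff j k - cutoff j n\<bar> \<le> \<bar>h k - h n\<bar> / real (Suc j)"
proof -
  have "\<bar>cutoff j k - cutoff j n\<bar> \<le> \<bar>(1 - h k / real (Suc j)) - (1 - h n / real (Suc j))\<bar>"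
    unfolding cutoff_def by linarith
  also have "\<dots> = \<bar>(h n - h k) / real (Suc j)\<bar>" by (simp add: diff_divide_distrib)
  finally show ?thesis by (simp add: abs_divide abs_minus_commute del: of_nat_Suc)
qed

lemma cutoff_in_Cc: "(\<lambda>n. f n * cutoff j n) \<in> Cc"
proof -
  obtain N where "\<And>n. N < n \<Longrightarrow> real (Suc j) \<le> h n" using eventually_h_ge by blast
  then have "{n. f n * cutoff j n \<noteq> 0} \<subseteq> {..N}"
    by (force simp: cutoff_def not_le[symmetric] simp del: of_nat_Suc)
  then show ?thesis by (auto simp: Cc_def intro: finite_subset)
qed

text \<open>The cutoffs tend to 1 only pointwise. Uniformity comes from \<open>f\<close>: it is
  small beyond \<open>K\<close>, and on the finitely many remaining states
  \<open>1 - cutoff j n \<le> h n / Suc j\<close>.\<close>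

lemma cutoff_uniform_limit:
  assumes f: "f \<in> C0"
  shows "uniform_limit UNIV (\<lambda>j n. f n * cutoff j n) f sequentially"
proof (rule uniform_limitI)
  fix e :: real assume e: "0 < e"
  obtain K where K: "\<And>n. K \<le> n \<Longrightarrow> \<bar>f n\<bar> < e" using C0E[OF f e] by blast
  define M where "M = (\<Sum>k<K. \<bar>f k\<bar> * h k)"
  have "(\<lambda>j. M / real (Suc j)) \<longlonglongrightarrow> 0" by real_asymp
  then have "\<forall>\<^sub>F j in sequentially. M / real (Suc j) < e" using e by (rule order_tendstoD)
  then show "\<forall>\<^sub>F j in sequentially. \<forall>n\<in>UNIV. dist (f n * cutoff j n) (f n) < e"
  proof eventually_elim
    case (elim j)
    show ?case
    proof
      fix n
      have "dist (f n * cutoff j n) (f n) = \<bar>f n * (cutoff j n - 1)\<bar>"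
        by (simp add: dist_real_def algebra_simps)
      then have d: "dist (f n * cutoff j n) (f n) = \<bar>f n\<bar> * (1 - cutoff j n)"
        using cutoff_bounds[of j n] by (simp add: abs_mult)
      show "dist (f n * cutoff j n) (f n) < e"
      proof (cases "n < K")
        case True
        have "1 - cutoff j n \<le> h n / real (Suc j)"
          unfolding cutoff_def by linarith
        then have "\<bar>f n\<bar> * (1 - cutoff j n) \<le> \<bar>f n\<bar> * (h n / real (Suc j))" by (intro mult_left_mono) auto
        also have "\<dots> = (\<bar>f n\<bar> * h n) / real (Suc j)" by simp
        also have "\<dots> \<le> M / real (Suc j)"
          unfolding M_def using True h_nonneg
          by (intro divide_right_mono member_le_sum[of n "{..<K}" "\<lambda>n. \<bar>f n\<bar> * h n"]) auto
        finally show ?thesis using d elim by linarith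
      next
        case False
        have "\<bar>f n\<bar> * (1 - cutoff j n) \<le> \<bar>f n\<bar> * 1"
          using cutoff_bounds[of j n] by (intro mult_left_mono) auto
        then show ?thesis using d K[of n] False by simp
      qed
    qed
  qed
qed

text \<open>The commutator sums \<open>q n k * f k\<close> against increments of the cutoff. The
  diagonal term drops out, and the cutoff is Lipschitz in \<open>h\<close> with constant
  \<open>1 / Suc j\<close>, so \<open>h_rate\<close> bounds the rest.\<close>

lemma gen_cutoff_commutator:
  assumes B: "\<And>n. \<bar>f n\<bar> \<le> B"
  shows "\<bar>gen (\<lambda>k. f k * cutoff j k) n - gen f n * cutoff j n\<bar> \<le> B * C / real (Suc j)"
proof -
  have "gen (\<lambda>k. f k * cutoff j k) n - gen f n * cutoff j n = (\<Sum>k\<le>Suc n. q n k * (f k * (cutoff j k - cutoff j n)))"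
    unfolding gen_def sum_distrib_right sum_subtractf[symmetric]
    by (intro sum.cong) (simp_all add: algebra_simps)
  also have "\<bar>\<dots>\<bar> \<le> (\<Sum>k\<le>Suc n. q n k * \<bar>h k - h n\<bar> * (B / real (Suc j)))"
  proof (rule order.trans[OF sum_abs], rule sum_mono)
    fix k
    show "\<bar>q n k * (f k * (cutoff j k - cutoff j n))\<bar> \<le> q n k * \<bar>h k - h n\<bar> * (B / real (Suc j))"
    proof (cases "k = n")
      case False
      have "\<bar>f k * (cutoff j k - cutoff j n)\<bar> \<le> B * (\<bar>h k - h n\<bar> / real (Suc j))"
        unfolding abs_mult using B[of k] by (intro mult_mono cutoff_diff) auto
      then have "q n k * \<bar>f k * (cutoff j k - cutoff j n)\<bar> \<le> q n k * (B * (\<bar>h k - h n\<bar> / real (Suc j)))"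
        by (rule mult_left_mono[OF _ q_nonneg[OF False]])
      then show ?thesis using q_nonneg[OF False] by (simp add: abs_mult mult_ac del: of_nat_Suc)
    qed simp
  qed
  also have "\<dots> = (\<Sum>k\<le>Suc n. q n k * \<bar>h k - h n\<bar>) * (B / real (Suc j))"
    by (simp only: sum_distrib_right)
  also have "\<dots> \<le> C * (B / real (Suc j))"
    using h_rate B[of 0] by (intro mult_right_mono) auto
  finally show ?thesis by (simp add: mult_ac)
qed

lemma gen_cutoff_uniform_limit:
  assumes f: "f \<in> C0" and g: "gen f \<in> C0"
  shows "uniform_limit UNIV (\<lambda>j. gen (\<lambda>k. f k * cutoff j k)) (gen f) sequentially"
proof (rule uniform_limitI)
  fix e :: real assume e: "0 < e"
  obtain B where B: "0 \<le> B" "\<And>n. \<bar>f n\<bar> \<le> B" using CbD f C0_subset_Cb by blast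
  have "(\<lambda>j. B * C / real (Suc j)) \<longlonglongrightarrow> 0" by real_asymp
  then have "\<forall>\<^sub>F j in sequentially. B * C / real (Suc j) < e / 2" using e by (intro order_tendstoD) auto
  moreover have "\<forall>\<^sub>F j in sequentially. \<forall>n\<in>UNIV. dist (gen f n * cutoff j n) (gen f n) < e / 2"
    using e by (intro uniform_limitD[OF cutoff_uniform_limit[OF g]]) auto
  ultimately show "\<forall>\<^sub>F j in sequentially. \<forall>n\<in>UNIV. dist (gen (\<lambda>k. f k * cutoff j k) n) (gen f n) < e"
  proof eventually_elim
    case (elim j)
    show ?case
    proof
      fix n
      have "\<bar>gen (\<lambda>k. f k * cutoff j k) n - gen f n * cutoff j n\<bar> \<le> B * C / real (Suc j)"
        using B by (intro gen_cutoff_commutator)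
      moreover have "\<bar>gen f n * cutoff j n - gen f n\<bar> < e / 2"
        using elim(2) by (simp add: dist_real_def)
      ultimately show "dist (gen (\<lambda>k. f k * cutoff j k) n) (gen f n) < e"
        using elim(1) unfolding dist_real_def by linarith
    qed
  qed
qed

text \<open>A uniform derivative at 0 is a pointwise one, which the backward equation identifies as
  \<open>gen f\<close>. Conversely, \<open>flow_second_order\<close> makes the pointwise derivative
  uniform as soon as \<open>gen f\<close> vanishes at infinity.\<close>

lemma generator_chain: "generator chain = {(f, gen f) | f. f \<in> C0 \<and> gen f \<in> C0}"
proof (intro equalityI subsetI)
  fix p assume "p \<in> generator chain"
  then obtain f g where p: "p = (f, g)" and fg: "f \<in> C0" "g \<in> C0"
    and lim: "uniform_limit UNIV (\<lambda>t n. (semigroup_of chain t f n - f n) / t) g (at_right 0)"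
    by (auto simp: generator_def)
  have f: "f \<in> Cb" using fg C0_subset_Cb by blast
  have "g n = gen f n" for n
  proof (rule tendsto_unique[of "at_right (0::real)"])
    show "((\<lambda>t. (semigroup_of chain t f n - f n) / t) \<longlongrightarrow> g n) (at_right 0)"
      using tendsto_uniform_limitI[OF lim, of n] by simp
    have "((\<lambda>t. flow f t n) has_real_derivative gen f n) (at 0 within {0..})"
      using flow_deriv[OF f, of 0 n] by (simp add: flow_0[OF f])
    then have "((\<lambda>t. flow f t n) has_real_derivative gen f n) (at_right 0)"
      by (rule DERIV_subset) auto
    then have "((\<lambda>t. (flow f t n - f n) / t) \<longlongrightarrow> gen f n) (at_right 0)"
      by (simp add: has_field_derivative_iff flow_0[OF f])
    then show "((\<lambda>t. (semigroup_of chain t f n - f n) / t) \<longlongrightarrow> gen f n) (at_right 0)"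
    proof (rule Lim_transform_eventually)
      show "\<forall>\<^sub>F t in at_right 0. (flow f t n - f n) / t = (semigroup_of chain t f n - f n) / t"
        using eventually_at_right_less[of "0::real"] by eventually_elim (simp add: semigroup_of_chain f)
    qed
  qed simp
  then have "g = gen f" by blast
  then show "p \<in> {(f, gen f) | f. f \<in> C0 \<and> gen f \<in> C0}" using p fg by blast
next
  fix p assume "p \<in> {(f, gen f) | f. f \<in> C0 \<and> gen f \<in> C0}"
  then obtain f where p: "p = (f, gen f)" and fg: "f \<in> C0" "gen f \<in> C0" by blast
  have f: "f \<in> Cb" using fg C0_subset_Cb by blast
  have "uniform_limit UNIV (\<lambda>t n. (semigroup_of chain t f n - f n) / t) (gen f) (at_right 0)"
  proof (rule uniform_limitI)
    fix r :: real assume r: "0 < r"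
    \<comment> \<open>The second-order estimate needs a function with bounded image under
      \<open>gen\<close>. This is not known for \<open>gen f\<close> itself, but holds for a nearby
      \<open>g\<close> of finite support.\<close>
    obtain g where g: "g \<in> Cc" "\<And>n. \<bar>gen f n - g n\<bar> \<le> r / 3" using C0_approx_Cc[OF fg(2), of "r / 3"] r by auto
    have gCb: "g \<in> Cb" using g Cc_subset_C0 C0_subset_Cb by blast
    have "gen g \<in> Cb" using gen_in_C0[OF g(1)] C0_subset_Cb by blast
    then obtain M where M: "0 \<le> M" "\<And>n. \<bar>gen g n\<bar> \<le> M" using CbD by blast
    have "((\<lambda>t. M * t) \<longlongrightarrow> M * 0) (at_right 0)" by (intro tendsto_intros)
    then have "\<forall>\<^sub>F t in at_right 0. M * t < r / 3" using r by (intro order_tendstoD) auto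
    then show "\<forall>\<^sub>F t in at_right 0. \<forall>n\<in>UNIV. dist ((semigroup_of chain t f n - f n) / t) (gen f n) < r"
      using eventually_at_right_less[of "0::real"]
    proof eventually_elim
      case (elim t)
      show ?case
      proof
        fix n
        have "\<bar>flow f t n - f n - t * g n\<bar> \<le> r / 3 * t + M * t\<^sup>2"
          using elim by (intro flow_second_order f gCb g M) auto
        then have "\<bar>(flow f t n - f n - t * g n) / t\<bar> \<le> r / 3 + M * t"
          using elim by (simp add: abs_divide field_simps power2_eq_square)
        also have "(flow f t n - f n - t * g n) / t = (flow f t n - f n) / t - g n"
          using elim by (simp add: field_simps)
        finally have "\<bar>(flow f t n - f n) / t - g n\<bar> \<le> r / 3 + M * t" .
        moreover have "\<bar>x - gen f n\<bar> < r" if "\<bar>x - g n\<bar> \<le> r / 3 + M * t" for x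
          using that elim(1) g(2)[of n] by linarith
        ultimately show "dist ((semigroup_of chain t f n - f n) / t) (gen f n) < r"
          using elim f by (simp only: dist_real_def semigroup_of_chain less_imp_le)
      qed
    qed
  qed
  then show "p \<in> generator chain" using p fg by (simp add: generator_def)
qed

text \<open>The maximal operator is closed because \<open>gen\<close> reads finitely many values per
  row, so pointwise convergence suffices. Conversely, the cutoffs approximate both \<open>f\<close>
  and \<open>gen f\<close>.\<close>

lemma generates_chain: "generates gen Cc chain"
  unfolding generates_def generator_chain
proof (intro equalityI subsetI)
  fix p assume "p \<in> graph_closure (graph_on Cc gen)"
  then obtain f g F H where p: "p = (f, g)" and FH: "\<And>k. (F k, H k) \<in> graph_on Cc gen"
    and lim: "uniform_limit UNIV F f sequentially" "uniform_limit UNIV H g sequentially"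
    by (auto simp: graph_closure_def)
  have F: "F k \<in> Cc" and H: "H k = gen (F k)" for k
    using FH[of k] by (auto simp: graph_on_def)
  have "f \<in> C0" using F Cc_subset_C0 by (intro C0_uniform_limit[OF _ lim(1)]) auto
  moreover have "g \<in> C0" using F H gen_in_C0 by (intro C0_uniform_limit[OF _ lim(2)]) simp
  moreover have "g n = gen f n" for n
  proof (rule LIMSEQ_unique)
    show "(\<lambda>k. H k n) \<longlonglongrightarrow> g n" using tendsto_uniform_limitI[OF lim(2)] by simp
    show "(\<lambda>k. H k n) \<longlonglongrightarrow> gen f n"
      unfolding H gen_def using tendsto_uniform_limitI[OF lim(1)] by (intro tendsto_intros) simp
  qed
  then have "g = gen f" by blast
  ultimately show "p \<in> {(f, gen f) | f. f \<in> C0 \<and> gen f \<in> C0}" using p by blast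
next
  fix p assume "p \<in> {(f, gen f) | f. f \<in> C0 \<and> gen f \<in> C0}"
  then obtain f where "p = (f, gen f)" "f \<in> C0" "gen f \<in> C0" by blast
  moreover have "((\<lambda>n. f n * cutoff j n), gen (\<lambda>n. f n * cutoff j n)) \<in> graph_on Cc gen" for j
    unfolding graph_on_def using cutoff_in_Cc by fast
  ultimately show "p \<in> graph_closure (graph_on Cc gen)"
    using graph_closureI[OF _ cutoff_uniform_limit[of f] gen_cutoff_uniform_limit[of f]] by simp
qed

lemma core_chain: "core Cc (generator chain)"
proof -
  have "generator chain \<inter> Cc \<times> UNIV = graph_on Cc gen"
    using Cc_subset_C0 gen_in_C0 by (auto simp: generator_chain graph_on_def)
  moreover have "Cc \<subseteq> Domain (generator chain)"
    using Cc_subset_C0 gen_in_C0 by (auto simp: generator_chain)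
  ultimately show ?thesis
    using generates_chain by (simp add: core_def generates_def)
qed

text \<open>Differentiating \<open>dilation \<alpha> (flow f (\<alpha> * t))\<close> in time
  produces a factor \<open>\<alpha>\<close> which the commutation relation absorbs. It is thus the
  bounded solution started from \<open>dilation \<alpha> f\<close>.\<close>

lemma discrete_self_similar_chain:
  assumes commute: "\<And>\<alpha> f n. gen (dilation \<alpha> f) n = \<alpha> * dilation \<alpha> (gen f) n"
  shows "discrete_self_similar chain"
  unfolding discrete_self_similar_def
proof (intro allI impI ballI)
  fix t \<alpha> :: real and f assume t: "0 \<le> t" and \<alpha>: "\<alpha> \<in> {0..1}" and f: "f \<in> Cb"
  have "solves (dilation \<alpha> f) (\<lambda>t. dilation \<alpha> (flow f (\<alpha> * t)))"
    unfolding solves_def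
  proof (intro conjI allI impI)
    obtain B where B: "\<And>n. \<bar>f n\<bar> \<le> B" using CbD[OF f] by blast
    show "\<exists>B. \<forall>t\<ge>0. \<forall>n. \<bar>dilation \<alpha> (flow f (\<alpha> * t)) n\<bar> \<le> B"
      using \<alpha> by (intro exI[of _ B] allI impI dilation_bound flow_bound B) auto
    show "dilation \<alpha> (flow f (\<alpha> * 0)) = dilation \<alpha> f" by (simp add: flow_0 f)
    fix s :: real and n assume s: "0 \<le> s"
    have d: "((\<lambda>s. flow f (\<alpha> * s) r) has_real_derivative gen (flow f (\<alpha> * s)) r * \<alpha>) (at s within {0..})" for r
    proof -
      have "((\<lambda>s. flow f s r) \<circ> (\<lambda>s. \<alpha> * s) has_real_derivative gen (flow f (\<alpha> * s)) r * \<alpha>) (at s within {0..})"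
      proof (rule DERIV_image_chain)
        show "((\<lambda>s. flow f s r) has_real_derivative gen (flow f (\<alpha> * s)) r) (at (\<alpha> * s) within (\<lambda>s. \<alpha> * s) ` {0..})"
          by (rule DERIV_subset[OF flow_deriv[OF f]]) (use s \<alpha> in auto)
      qed (auto intro!: derivative_eq_intros)
      then show ?thesis by (simp add: o_def)
    qed
    have "((\<lambda>s. dilation \<alpha> (flow f (\<alpha> * s)) n) has_real_derivative
        dilation \<alpha> (\<lambda>r. gen (flow f (\<alpha> * s)) r * \<alpha>) n) (at s within {0..})"
      unfolding dilation_def by (intro DERIV_sum DERIV_cmult d)
    also have "dilation \<alpha> (\<lambda>r. gen (flow f (\<alpha> * s)) r * \<alpha>) n = gen (dilation \<alpha> (flow f (\<alpha> * s))) n"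
      using dilation_cmult[of \<alpha> \<alpha> "gen (flow f (\<alpha> * s))" n] by (simp add: commute mult.commute)
    finally show "((\<lambda>s. dilation \<alpha> (flow f (\<alpha> * s)) n) has_real_derivative gen (dilation \<alpha> (flow f (\<alpha> * s))) n)
      (at s within {0..})" .
  qed
  from flow_eq[OF this t] show "semigroup_of chain t (dilation \<alpha> f) = dilation \<alpha> (semigroup_of chain (\<alpha> * t) f)"
    using t \<alpha> f by (simp add: semigroup_of_chain dilation_in_Cb)
qed

end

section \<open>The operator of a triplet\<close>

locale triplet =
  fixes m \<sigma>2 :: real and \<mu> :: "real measure"
  assumes m_nonneg: "0 \<le> m" and \<sigma>2_nonneg: "0 \<le> \<sigma>2"
    and sets_\<mu>: "sets \<mu> = sets (restrict_space borel {0<..})"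
    and finite_min: "(\<integral>\<^sup>+ y. ennreal (min y (y\<^sup>2)) \<partial>\<mu>) < \<infinity>"
begin

lemma space_\<mu>: "space \<mu> = {0<..}"
  using sets_eq_imp_space_eq[OF sets_\<mu>] by (simp add: space_restrict_space)

lemma borel_measurable_\<mu>: "f \<in> borel_measurable borel \<Longrightarrow> f \<in> borel_measurable \<mu>"
  for f :: "real \<Rightarrow> real"
  using measurable_cong_sets[OF sets_\<mu> refl] measurable_restrict_space1 by blast

lemma integrable_min: "integrable \<mu> (\<lambda>y. min y (y\<^sup>2))"
proof (rule integrableI_bounded)
  have "(\<integral>\<^sup>+ y. ennreal (norm (min y (y\<^sup>2))) \<partial>\<mu>) = (\<integral>\<^sup>+ y. ennreal (min y (y\<^sup>2)) \<partial>\<mu>)"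
    by (intro nn_integral_cong) (auto simp: space_\<mu>)
  then show "(\<integral>\<^sup>+ y. ennreal (norm (min y (y\<^sup>2))) \<partial>\<mu>) < \<infinity>" using finite_min by simp
qed (intro borel_measurable_\<mu>, measurable)

definition mass :: real where
  "mass = (LINT y|\<mu>. min y (y\<^sup>2))"

text \<open>By \<open>compensator_le\<close> the integrand is at most the minimum of
  \<open>u * y\<close> and its square, hence at most a constant times
  \<open>min y (y\<^sup>2)\<close>.\<close>

lemma integrable_compensator:
  assumes "0 \<le> u" shows "integrable \<mu> (\<lambda>y. compensator (u * y))"
proof (rule Bochner_Integration.integrable_bound)
  show "integrable \<mu> (\<lambda>y. (u + u\<^sup>2) * min y (y\<^sup>2))"
    by (intro integrable_mult_right integrable_min)
  show "(\<lambda>y. compensator (u * y)) \<in> borel_measurable \<mu>"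
    unfolding compensator_def by (intro borel_measurable_\<mu>) measurable
  show "AE y in \<mu>. norm (compensator (u * y)) \<le> norm ((u + u\<^sup>2) * min y (y\<^sup>2))"
  proof (rule AE_I2)
    fix y assume "y \<in> space \<mu>"
    then have y: "0 < y" by (simp add: space_\<mu>)
    have c: "compensator (u * y) \<le> (u * y)\<^sup>2 / (1 + u * y)"
      using assms y by (intro compensator_le) auto
    have "(u * y)\<^sup>2 / (1 + u * y) \<le> u * y" "(u * y)\<^sup>2 / (1 + u * y) \<le> u\<^sup>2 * y\<^sup>2"
      using assms y by (simp_all add: field_simps power2_eq_square add_pos_nonneg)
    then have "compensator (u * y) \<le> min (u * y) (u\<^sup>2 * y\<^sup>2)" using c by simp
    also have "\<dots> \<le> (u + u\<^sup>2) * min y (y\<^sup>2)"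
      using assms y by (auto simp: min_def algebra_simps mult_nonneg_nonneg intro: add_increasing add_increasing2)
    finally show "norm (compensator (u * y)) \<le> norm ((u + u\<^sup>2) * min y (y\<^sup>2))"
      using compensator_nonneg[of "u * y"] assms y by simp
  qed
qed

section \<open>Action of the operator on binomial coefficients\<close>

definition jump :: "(nat \<Rightarrow> real) \<Rightarrow> nat \<Rightarrow> real \<Rightarrow> real" where
  "jump f n y = dilation (exp (- y)) f (n + 1) - f (n + 1) + y * (real n + 1) * dplus f n"

lemma G_op_jump:
  "G_op m \<sigma>2 \<mu> f n = \<sigma>2 * real n * (dplus f n + dminus f n) + (m + \<sigma>2) * dplus f n
    + 1 / (real n + 1) * (LINT y|\<mu>. jump f n y)"
  by (simp add: G_op_def jump_def)

lemma jump_sum: "jump (\<lambda>i. \<Sum>j\<in>I. c j * g j i) n y = (\<Sum>j\<in>I. c j * jump (g j) n y)"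
  by (simp add: jump_def dilation_sum dplus_def sum_subtractf[symmetric] sum.distrib[symmetric] sum_distrib_left algebra_simps)

lemma jump_cong: "(\<And>i. i \<le> Suc n \<Longrightarrow> f i = g i) \<Longrightarrow> jump f n y = jump g n y"
  using dilation_cong[of "n + 1" f g] by (simp add: jump_def dplus_def)

text \<open>Thinning contributes the eigenvalue \<open>exp (- (j * y))\<close>, and by absorption
  the drift correction equals \<open>j * y\<close> times the same binomial coefficient; together
  they form the compensator.\<close>

lemma jump_binomial:
  "jump (\<lambda>i. real (i choose j)) n y = real (Suc n choose j) * compensator (real j * y)"
proof -
  have "(real n + 1) * (real (Suc n choose j) - real (n choose j)) = real j * real (Suc n choose j)"
  proof (cases j)
    case (Suc i)
    have "real (Suc i) * real (Suc n choose Suc i) = real (Suc n) * real (n choose i)"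
      by (metis Suc_times_binomial of_nat_mult)
    then show ?thesis using Suc by (simp add: algebra_simps)
  qed simp
  then have "y * (real n + 1) * dplus (\<lambda>i. real (i choose j)) n = y * (real j * real (Suc n choose j))"
    by (simp add: dplus_def mult.assoc)
  moreover have "exp (- y) ^ j = exp (- (real j * y))"
    by (simp add: exp_of_nat_mult[symmetric])
  ultimately show ?thesis
    by (simp add: jump_def dilation_binomial compensator_def algebra_simps del: binomial_Suc_Suc)
qed

text \<open>Only values of \<open>f\<close> up to \<open>Suc n\<close> enter, so the integrand is a
  finite combination of compensators.\<close>

lemma integrable_jump: "integrable \<mu> (jump f n)"
proof -
  obtain c where c: "\<And>i. i \<le> Suc n \<Longrightarrow> f i = (\<Sum>j\<le>Suc n. c j * real (i choose j))"
    using binomial_basis by blast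
  have "jump f n = (\<lambda>y. \<Sum>j\<le>Suc n. c j * jump (\<lambda>i. real (i choose j)) n y)"
    unfolding jump_sum[symmetric] by (intro ext jump_cong c)
  then show ?thesis
    by (simp only: jump_binomial) (intro Bochner_Integration.integrable_sum integrable_mult_right integrable_compensator, simp)
qed

lemma G_op_sum: "G_op m \<sigma>2 \<mu> (\<lambda>i. \<Sum>j\<in>I. c j * g j i) n = (\<Sum>j\<in>I. c j * G_op m \<sigma>2 \<mu> (g j) n)"
proof -
  have "(LINT y|\<mu>. jump (\<lambda>i. \<Sum>j\<in>I. c j * g j i) n y) = (\<Sum>j\<in>I. c j * (LINT y|\<mu>. jump (g j) n y))"
    unfolding jump_sum by (subst Bochner_Integration.integral_sum) (auto intro: integrable_jump)
  then show ?thesis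
    unfolding G_op_jump
    by (simp add: dplus_def dminus_def sum_subtractf[symmetric] sum.distrib[symmetric] sum_distrib_left algebra_simps)
qed

lemma G_op_cong: "(\<And>i. i \<le> Suc n \<Longrightarrow> f i = g i) \<Longrightarrow> G_op m \<sigma>2 \<mu> f n = G_op m \<sigma>2 \<mu> g n"
proof -
  assume fg: "\<And>i. i \<le> Suc n \<Longrightarrow> f i = g i"
  then have "jump f n = jump g n" by (intro ext jump_cong)
  then show ?thesis unfolding G_op_jump using fg by (simp add: dplus_def dminus_def)
qed

lemma G_op_binomial_0: "G_op m \<sigma>2 \<mu> (\<lambda>i. real (i choose 0)) n = 0"
  unfolding G_op_jump jump_binomial by (simp add: dplus_def dminus_def compensator_def)

text \<open>The operator lowers the binomial degree by one. After integrating by parts in the tail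
  integral of \<open>\<phi>\<close>, the constant is recognised as
  \<open>\<phi> (j + 1)\<close>.\<close>

lemma G_op_binomial_Suc:
  "G_op m \<sigma>2 \<mu> (\<lambda>i. real (i choose Suc j)) n
    = (\<sigma>2 * (real j + 1) + m + (LINT y|\<mu>. compensator (real (Suc j) * y)) / (real j + 1)) * real (n choose j)"
proof -
  have "real (Suc j) * real (Suc n choose Suc j) = real (Suc n) * real (n choose j)"
    by (metis Suc_times_binomial of_nat_mult)
  then have quot: "real (Suc n choose Suc j) / (real n + 1) = real (n choose j) / (real j + 1)"
    by (simp add: field_simps del: binomial_Suc_Suc)
  have drift: "real n * (dplus (\<lambda>i. real (i choose Suc j)) n + dminus (\<lambda>i. real (i choose Suc j)) n) = real j * real (n choose j)"
  proof (cases n)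
    case (Suc k)
    show ?thesis
    proof (cases j)
      case (Suc l)
      have "real (Suc l) * real (Suc k choose Suc l) = real (Suc k) * real (k choose l)"
        by (metis Suc_times_binomial of_nat_mult)
      then show ?thesis using Suc \<open>n = Suc k\<close> by (simp add: dplus_def dminus_def algebra_simps)
    qed (simp add: dplus_def dminus_def Suc)
  qed (cases j; simp)
  have "dplus (\<lambda>i. real (i choose Suc j)) n = real (n choose j)" by (simp add: dplus_def)
  then have "G_op m \<sigma>2 \<mu> (\<lambda>i. real (i choose Suc j)) n
    = \<sigma>2 * (real j * real (n choose j)) + (m + \<sigma>2) * real (n choose j)
      + (real (Suc n choose Suc j) / (real n + 1)) * (LINT y|\<mu>. compensator (real (Suc j) * y))"
    unfolding G_op_jump jump_binomial drift[symmetric] by simp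
  then show ?thesis unfolding quot by (simp add: algebra_simps add_divide_distrib)
qed

text \<open>Both sides are linear and depend on finitely many values of \<open>f\<close>. On
  \<open>i choose j\<close> the left side carries the factor \<open>\<alpha> ^ j\<close>; on the
  right the degree has dropped by one, which leaves \<open>\<alpha> * \<alpha> ^ (j - 1)\<close>.
  For \<open>j = 0\<close> both sides vanish.\<close>

lemma G_op_dilation: "G_op m \<sigma>2 \<mu> (dilation \<alpha> f) n = \<alpha> * dilation \<alpha> (G_op m \<sigma>2 \<mu> f) n"
proof -
  let ?b = "\<lambda>j i. real (i choose j)"
  obtain c where c: "\<And>i. i \<le> Suc n \<Longrightarrow> f i = (\<Sum>j\<le>Suc n. c j * ?b j i)"
    using binomial_basis by blast
  have "G_op m \<sigma>2 \<mu> (dilation \<alpha> f) n = G_op m \<sigma>2 \<mu> (\<lambda>i. \<Sum>j\<le>Suc n. c j * dilation \<alpha> (?b j) i) n"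
    unfolding dilation_sum[symmetric] by (intro G_op_cong dilation_cong c) simp
  also have "\<dots> = (\<Sum>j\<le>Suc n. c j * G_op m \<sigma>2 \<mu> (dilation \<alpha> (?b j)) n)"
    by (rule G_op_sum)
  also have "\<dots> = (\<Sum>j\<le>Suc n. c j * (\<alpha> * dilation \<alpha> (G_op m \<sigma>2 \<mu> (?b j)) n))"
  proof (intro sum.cong refl arg_cong2[of _ _ _ _ "(*)"])
    fix j
    have "G_op m \<sigma>2 \<mu> (dilation \<alpha> (?b j)) n = \<alpha> ^ j * G_op m \<sigma>2 \<mu> (?b j) n"
      \<comment> \<open>Homogeneity is obtained from the sum rule with a one-element index
        set.\<close>
      using G_op_sum[of "\<lambda>_. \<alpha> ^ j" "\<lambda>_. ?b j" "{0::nat}"] by (simp add: dilation_binomial[abs_def])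
    also have "\<dots> = \<alpha> * dilation \<alpha> (G_op m \<sigma>2 \<mu> (?b j)) n"
    proof (cases j)
      case 0
      then show ?thesis unfolding 0 G_op_binomial_0 by (simp add: dilation_const)
    next
      case (Suc i)
      show ?thesis unfolding Suc G_op_binomial_Suc dilation_cmult dilation_binomial by simp
    qed
    finally show "G_op m \<sigma>2 \<mu> (dilation \<alpha> (?b j)) n = \<alpha> * dilation \<alpha> (G_op m \<sigma>2 \<mu> (?b j)) n" .
  qed
  also have "\<dots> = \<alpha> * dilation \<alpha> (\<lambda>i. \<Sum>j\<le>Suc n. c j * G_op m \<sigma>2 \<mu> (?b j) i) n"
    unfolding dilation_sum sum_distrib_left by (intro sum.cong) simp_all
  also have "dilation \<alpha> (\<lambda>i. \<Sum>j\<le>Suc n. c j * G_op m \<sigma>2 \<mu> (?b j) i) n = dilation \<alpha> (G_op m \<sigma>2 \<mu> f) n"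
    unfolding G_op_sum[symmetric] by (intro dilation_cong G_op_cong c[symmetric]) simp
  finally show ?thesis .
qed

section \<open>Jump rates and the logarithmic Lyapunov estimate\<close>

definition rate :: "nat \<Rightarrow> nat \<Rightarrow> real" where
  "rate n k = G_op m \<sigma>2 \<mu> (\<lambda>j. of_bool (j = k)) n"

lemma G_op_eq_rate_sum: "G_op m \<sigma>2 \<mu> f n = (\<Sum>k\<le>Suc n. rate n k * f k)"
proof -
  have "G_op m \<sigma>2 \<mu> f n = G_op m \<sigma>2 \<mu> (\<lambda>i. \<Sum>k\<le>Suc n. f k * of_bool (i = k)) n"
    by (intro G_op_cong) (simp add: of_bool_def if_distrib[of "\<lambda>x. _ * x"] del: sum.atMost_Suc cong: if_cong)
  also have "\<dots> = (\<Sum>k\<le>Suc n. rate n k * f k)"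
    by (simp only: G_op_sum rate_def mult.commute)
  finally show ?thesis .
qed

lemma jump_of_bool_top: "jump (\<lambda>j. of_bool (j = Suc n)) n y = compensator ((real n + 1) * y)"
proof -
  have "exp (- y) ^ Suc n = exp (- ((real n + 1) * y))"
    by (simp only: exp_of_nat_mult[symmetric]) (simp add: algebra_simps)
  then show ?thesis
    by (simp add: jump_def dilation_of_bool dplus_def compensator_def mult_ac del: power_Suc)
qed

lemma jump_of_bool:
  "k \<noteq> n \<Longrightarrow> k \<noteq> Suc n \<Longrightarrow> jump (\<lambda>j. of_bool (j = k)) n y
    = real (Suc n choose k) * exp (- y) ^ k * (1 - exp (- y)) ^ (Suc n - k)"
  by (simp add: jump_def dilation_of_bool dplus_def del: power_Suc binomial_Suc_Suc)

text \<open>The upward integrand is a compensator; for the other targets away from \<open>n\<close>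
  it is a binomial probability, zero beyond \<open>Suc n\<close>. The nearest-neighbour terms have
  nonnegative coefficients.\<close>

lemma rate_nonneg:
  assumes "k \<noteq> n" shows "0 \<le> rate n k"
proof -
  have "0 \<le> jump (\<lambda>j. of_bool (j = k)) n y" if "0 < y" for y
  proof (cases "k = Suc n")
    case True then show ?thesis using jump_of_bool_top compensator_nonneg by simp
  next
    case False then show ?thesis using assms that by (subst jump_of_bool) auto
  qed
  then have "0 \<le> (LINT y|\<mu>. jump (\<lambda>j. of_bool (j = k)) n y)"
    by (intro integral_nonneg_AE AE_I2) (simp add: space_\<mu>)
  then show ?thesis
    using assms m_nonneg \<sigma>2_nonneg unfolding rate_def G_op_jump dplus_def dminus_def by auto
qed

lemma rate_row_sum: "(\<Sum>k\<le>Suc n. rate n k) = 0"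
  using G_op_eq_rate_sum[of "\<lambda>i. real (i choose 0)" n] G_op_binomial_0[of n] by simp

text \<open>The upward rate grows at most linearly, while a step up changes \<open>harm\<close> by
  \<open>1 / (n + 1)\<close>. The integral carries the square of \<open>n + 1\<close> in its
  denominator, matching \<open>compensator x \<le> min x (x\<^sup>2)\<close> at
  \<open>x = (n + 1) * y\<close>.\<close>

lemma rate_up_le: "rate n (Suc n) / (real n + 1) \<le> \<sigma>2 + m + mass"
proof -
  define I where "I = (LINT y|\<mu>. compensator ((real n + 1) * y))"
  have "I \<le> (LINT y|\<mu>. (real n + 1)\<^sup>2 * min y (y\<^sup>2))"
    unfolding I_def
  proof (rule integral_mono_AE)
    show "AE y in \<mu>. compensator ((real n + 1) * y) \<le> (real n + 1)\<^sup>2 * min y (y\<^sup>2)"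
    proof (rule AE_I2)
      fix y assume "y \<in> space \<mu>"
      then have y: "0 < y" by (simp add: space_\<mu>)
      define x where "x = (real n + 1) * y"
      have x: "0 \<le> x" using y by (simp add: x_def)
      have "compensator x \<le> x\<^sup>2 / (1 + x)" using x by (rule compensator_le)
      moreover have "x\<^sup>2 / (1 + x) \<le> x\<^sup>2" using x by (simp add: field_simps)
      moreover have "x\<^sup>2 / (1 + x) \<le> x" using x by (simp add: field_simps power2_eq_square)
      moreover have "x \<le> (real n + 1)\<^sup>2 * y" "x\<^sup>2 = (real n + 1)\<^sup>2 * y\<^sup>2"
        using y by (auto simp: x_def power2_eq_square)
      ultimately show "compensator ((real n + 1) * y) \<le> (real n + 1)\<^sup>2 * min y (y\<^sup>2)"
        unfolding x_def[symmetric] by (auto simp: min_def)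
    qed
  qed (auto intro: integrable_compensator integrable_min)
  then have "I / (real n + 1)\<^sup>2 \<le> mass"
    by (simp add: mass_def divide_le_eq mult.commute)
  moreover have I: "(LINT y|\<mu>. jump (\<lambda>j. of_bool (j = Suc n)) n y) = I"
    by (simp only: jump_of_bool_top I_def)
  have "rate n (Suc n) = \<sigma>2 * (real n + 1) + m + I / (real n + 1)"
    unfolding rate_def G_op_jump I by (cases n) (simp_all add: dplus_def dminus_def algebra_simps)
  then have "rate n (Suc n) / (real n + 1)
      = \<sigma>2 + m / (real n + 1) + I / (real n + 1)\<^sup>2"
    by (simp add: add_divide_distrib power2_eq_square)
  moreover have "m / (real n + 1) \<le> m"
    using m_nonneg by (simp add: divide_le_eq mult_le_cancel_left1 algebra_simps)
  ultimately show ?thesis by linarith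
qed

text \<open>Since \<open>dplus harm n\<close> is \<open>1 / (n + 1)\<close>, the drift correction is
  exactly \<open>y\<close> and outweighs the loss by thinning, so the jump part is nonnegative. The
  second difference of \<open>harm\<close> costs at most \<open>\<sigma>2\<close>.\<close>

lemma G_op_harm_ge: "- \<sigma>2 \<le> G_op m \<sigma>2 \<mu> harm n"
proof -
  have dplus: "dplus harm n = 1 / (real n + 1)"
    by (simp add: dplus_def harm_Suc inverse_eq_divide)
  have "0 \<le> jump harm n y" if "0 < y" for y
    using harm_minus_dilation_harm_le[of y "Suc n"] that unfolding jump_def dplus by simp
  then have "0 \<le> (LINT y|\<mu>. jump harm n y)"
    by (intro integral_nonneg_AE AE_I2) (simp add: space_\<mu>)
  then have "0 \<le> 1 / (real n + 1) * (LINT y|\<mu>. jump harm n y)" by simp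
  moreover have "- 1 \<le> real n * (dplus harm n + dminus harm n)"
  proof (cases n)
    case (Suc k)
    have "dminus harm n = - (1 / real n)"
      using Suc by (simp add: dminus_def harm_Suc inverse_eq_divide)
    then have "real n * (dplus harm n + dminus harm n) = real n / (real n + 1) - 1"
      unfolding dplus using Suc by (simp add: field_simps)
    then show ?thesis by simp
  qed simp
  then have "\<sigma>2 * (- 1) \<le> \<sigma>2 * (real n * (dplus harm n + dminus harm n))"
    using \<sigma>2_nonneg by (rule mult_left_mono)
  moreover have "0 \<le> (m + \<sigma>2) * dplus harm n"
    using m_nonneg \<sigma>2_nonneg by (simp add: dplus)
  ultimately show ?thesis unfolding G_op_jump by (simp add: mult.assoc)
qed

text \<open>As \<open>harm\<close> increases and only one target lies above \<open>n\<close>, the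
  absolute values equal the signed sum, which is minus the operator on \<open>harm\<close>, plus
  twice the upward contribution.\<close>

lemma rate_harm_le:
  "(\<Sum>k\<le>Suc n. rate n k * \<bar>harm k - harm n\<bar>) \<le> \<sigma>2 + 2 * (\<sigma>2 + m + mass)"
proof -
  have abs: "\<bar>harm k - harm n\<bar> = harm n - (harm k :: real)" if "k \<le> n" for k
    using harm_mono[OF that, where 'a = real] by simp
  have "(\<Sum>k\<le>Suc n. rate n k * \<bar>harm k - harm n\<bar>)
      = (\<Sum>k\<le>n. rate n k * (harm n - harm k)) + rate n (Suc n) * (1 / (real n + 1))"
    by (simp add: abs harm_Suc inverse_eq_divide)
  also have "\<dots> = (\<Sum>k\<le>Suc n. rate n k * (harm n - harm k)) + 2 * (rate n (Suc n) / (real n + 1))"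
    by (simp add: harm_Suc inverse_eq_divide add.commute)
  also have "(\<Sum>k\<le>Suc n. rate n k * (harm n - harm k)) = (\<Sum>k\<le>Suc n. rate n k) * harm n - G_op m \<sigma>2 \<mu> harm n"
    unfolding G_op_eq_rate_sum sum_distrib_right sum_subtractf[symmetric]
    by (intro sum.cong) (simp_all add: algebra_simps)
  finally show ?thesis
    using rate_row_sum[of n] G_op_harm_ge[of n] rate_up_le[of n] by simp
qed

text \<open>Passing from \<open>Suc n choose k\<close> to \<open>n - 1 choose k\<close> costs a
  bounded factor for fixed \<open>k\<close> and frees two powers of \<open>1 - exp (- y)\<close>,
  enough to beat \<open>min y (y\<^sup>2)\<close>. The prefactor \<open>1 / (n + 1)\<close> then
  makes the rate decay. \<open>Suc k < n\<close> excludes nearest-neighbour terms.\<close>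

lemma rate_down_le:
  assumes "Suc k < n" shows "rate n k \<le> (real k + 1) / (real n + 1 - real k) * mass"
proof -
  have choose: "real (Suc n choose k) \<le> (real n + 1) * (real k + 1) / (real n + 1 - real k) * real (n - 1 choose k)"
  proof -
    have "(Suc n - k) * (Suc n choose k) = Suc n * (n choose k)"
      using binomial_absorb_comp[of "Suc n" k] by simp
    then have 1: "(real n + 1 - real k) * real (Suc n choose k) = (real n + 1) * real (n choose k)"
      using assms by (metis (no_types, lifting) Suc_lessD add.commute less_imp_le less_SucI of_nat_Suc of_nat_diff of_nat_mult)
    have "(n - k) * (n choose k) = n * (n - 1 choose k)"
      by (rule binomial_absorb_comp)
    then have "(real n - real k) * real (n choose k) = real n * real (n - 1 choose k)"
      using assms by (metis Suc_lessD less_imp_le of_nat_diff of_nat_mult)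
    also have "\<dots> \<le> ((real n - real k) * (real k + 1)) * real (n - 1 choose k)"
    proof (rule mult_right_mono)
      have "real k * 1 \<le> real k * (real n - real k)" using assms by (intro mult_left_mono) auto
      then show "real n \<le> (real n - real k) * (real k + 1)" by (simp add: algebra_simps)
    qed simp
    finally have "real (n choose k) \<le> (real k + 1) * real (n - 1 choose k)"
      using assms by (simp add: mult.assoc)
    then have "(real n + 1) * real (n choose k) \<le> (real n + 1) * ((real k + 1) * real (n - 1 choose k))"
      by (intro mult_left_mono) auto
    with 1 have "(real n + 1 - real k) * real (Suc n choose k) \<le> (real n + 1) * ((real k + 1) * real (n - 1 choose k))"
      by simp
    then show ?thesis using assms by (simp add: field_simps)
  qed
  define K where "K = (real n + 1) * (real k + 1) / (real n + 1 - real k)"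
  have K: "0 \<le> K" using assms by (simp add: K_def)
  have "(LINT y|\<mu>. jump (\<lambda>j. of_bool (j = k)) n y) \<le> (LINT y|\<mu>. K * min y (y\<^sup>2))"
  proof (rule integral_mono_AE)
    show "AE y in \<mu>. jump (\<lambda>j. of_bool (j = k)) n y \<le> K * min y (y\<^sup>2)"
    proof (rule AE_I2)
      fix y assume "y \<in> space \<mu>"
      then have y: "0 < y" by (simp add: space_\<mu>)
      define p where "p = exp (- y)"
      have p: "0 \<le> p" "p \<le> 1" using y by (auto simp: p_def)
      have "1 - p \<le> y" using exp_ge_add_one_self[of "- y"] by (simp add: p_def)
      then have "(1 - p)\<^sup>2 \<le> y\<^sup>2" using p by (intro power_mono) auto
      moreover have "(1 - p) * (1 - p) \<le> 1 * y" using p \<open>1 - p \<le> y\<close> by (intro mult_mono) auto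
      ultimately have sq: "(1 - p)\<^sup>2 \<le> min y (y\<^sup>2)" by (simp add: power2_eq_square)
      \<comment> \<open>A single binomial probability, bounded by 1 as the thinning of an
        indicator.\<close>
      have prob: "real (n - 1 choose k) * p ^ k * (1 - p) ^ (n - 1 - k) \<le> 1"
        using dilation_bound[of p "\<lambda>j. of_bool (j = k)" 1 "n - 1"] p
        by (simp add: dilation_of_bool abs_le_iff)
      have "jump (\<lambda>j. of_bool (j = k)) n y = real (Suc n choose k) * (p ^ k * (1 - p) ^ (Suc n - k))"
        using assms by (simp add: jump_of_bool p_def del: binomial_Suc_Suc)
      also have "\<dots> \<le> (K * real (n - 1 choose k)) * (p ^ k * (1 - p) ^ (Suc n - k))"
        using choose p by (intro mult_right_mono) (auto simp: K_def)
      also have "Suc n - k = (n - 1 - k) + 2" using assms by simp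
      also have "(K * real (n - 1 choose k)) * (p ^ k * (1 - p) ^ ((n - 1 - k) + 2))
          = K * ((real (n - 1 choose k) * p ^ k * (1 - p) ^ (n - 1 - k)) * (1 - p)\<^sup>2)"
        unfolding power_add by (simp add: mult_ac)
      also have "\<dots> \<le> K * (1 * min y (y\<^sup>2))"
        using K prob sq by (intro mult_left_mono mult_mono) auto
      finally show "jump (\<lambda>j. of_bool (j = k)) n y \<le> K * min y (y\<^sup>2)" by simp
    qed
  qed (auto intro: integrable_jump integrable_min)
  then have "(LINT y|\<mu>. jump (\<lambda>j. of_bool (j = k)) n y) \<le> K * mass" by (simp add: mass_def)
  then have "1 / (real n + 1) * (LINT y|\<mu>. jump (\<lambda>j. of_bool (j = k)) n y) \<le> 1 / (real n + 1) * (K * mass)"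
    by (intro mult_left_mono) auto
  moreover have "n - 1 \<noteq> k" "n \<noteq> k" "n + 1 \<noteq> k" using assms by auto
  ultimately show ?thesis
    unfolding rate_def G_op_jump K_def by (simp add: dplus_def dminus_def)
qed

lemma rate_column_tendsto_0: "(\<lambda>n. rate n k) \<longlonglongrightarrow> 0"
proof (rule tendsto_sandwich)
  show "\<forall>\<^sub>F n in sequentially. 0 \<le> rate n k"
    using eventually_gt_at_top[of k] by eventually_elim (simp add: rate_nonneg)
  show "\<forall>\<^sub>F n in sequentially. rate n k \<le> (real k + 1) / (real n + 1 - real k) * mass"
    using eventually_gt_at_top[of "Suc k"] by eventually_elim (rule rate_down_le)
  show "(\<lambda>n. (real k + 1) / (real n + 1 - real k) * mass) \<longlonglongrightarrow> 0" by real_asymp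
qed simp

sublocale lyapunov_generator rate harm "\<sigma>2 + 2 * (\<sigma>2 + m + mass)"
proof
  show "0 \<le> rate n k" if "k \<noteq> n" for n k using that by (rule rate_nonneg)
qed (rule rate_row_sum harm_nonneg harm_at_top rate_harm_le rate_column_tendsto_0)+

lemma gen_eq_G_op: "gen = G_op m \<sigma>2 \<mu>"
  by (simp add: fun_eq_iff gen_def G_op_eq_rate_sum)

end

theorem theorem2p2:
  fixes \<phi> :: "real \<Rightarrow> real" and m \<sigma>2 :: real and \<mu> :: "real measure"
  assumes "\<phi> \<in> class_B" and "has_triplet \<phi> m \<sigma>2 \<mu>"
  shows "\<exists>P :: real \<Rightarrow> nat \<Rightarrow> nat pmf.
           feller_chain P \<and>
           generates (G_op m \<sigma>2 \<mu>) Cc P \<and>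
           discrete_self_similar P \<and>
           core Cc (generator P)"
proof -
  interpret triplet m \<sigma>2 \<mu>
    using assms(2) by unfold_locales (simp_all add: has_triplet_def)
  have "discrete_self_similar chain"
    by (rule discrete_self_similar_chain) (simp add: gen_eq_G_op G_op_dilation)
  then show ?thesis
    using feller_chain generates_chain core_chain unfolding gen_eq_G_op by blast
qed

end
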